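(* Let $G$ be a chordal bipartite graph. Then $G$ is cd-perfect. Consequently, for chordal bipartite graphs $G$ (without isolated vertices) one has $\gamma_t(G)=\chi_{cd}(G)=\omega_s(G)$, so the problems \textsc{Total Domination}, \textsc{CD-coloring} and \textsc{Separated-Cluster} are equivalent on this class, and each of them can be solved in $O(n^2)$ time, where $n=|V(G)|$.
   Context: Graphs are finite, simple, undirected; total domination is considered for graphs without isolated vertices. A chordal bipartite graph is a bipartite graph with no induced cycle of length at least $6$. A total dominating set is a set $S$ such that every vertex has a neighbour in $S$; $\gamma_t(G)$ is the minimum size of such a set. A cd-colouring is a proper colouring in which each colour class $C$ satisfies $C\subseteq N_G[v]$ for some vertex $v$ (equivalently $C\subseteq N_G(v)$ when $|C|\ge 2$; singleton classes always allowed); $\chi_{cd}(G)$ is the minimum number of colours in a cd-colouring. A separated-cluster is a set $S\subseteq V(G)$ containing no two vertices at distance exactly $2$ in $G$; $\omega_s(G)$ is the maximum size of a separated-cluster. $G$ is cd-perfect if $\chi_{cd}(H)=\omega_s(H)$ for every induced subgraph $H$ of $G$. The three problems ask, respectively, for $\gamma_t(G)$, $\chi_{cd}(G)$ and $\omega_s(G)$ (decision versions: total dominating set of size $\le k$, cd-colouring with $\le k$ colours, separated-cluster of size $\ge k$). *)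

theory Defs
  imports "Graph_Theory.Graph_Theory" "HOL-Library.Landau_Symbols"
begin

text \<open>
  A finite simple undirected graph is a \<open>graph\<close> in the sense of \<open>Graph_Theory\<close>, that is, a finite
  symmetric digraph without loops and parallel arcs; each edge is a pair of opposite arcs.
  The null graph is allowed.
\<close>

definition neighbors :: "('a, 'b) pre_digraph \<Rightarrow> 'a \<Rightarrow> 'a set" where
  "neighbors G v = {u \<in> verts G. v \<rightarrow>\<^bsub>G\<^esub> u}"

definition no_isolated :: "('a, 'b) pre_digraph \<Rightarrow> bool" where
  "no_isolated G \<longleftrightarrow> (\<forall>v \<in> verts G. neighbors G v \<noteq> {})"

definition bipartite :: "('a, 'b) pre_digraph \<Rightarrow> bool" where
  "bipartite G \<longleftrightarrow> (\<exists>A B. A \<union> B = verts G \<and> A \<inter> B = {} \<and>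
     (\<forall>u v. u \<rightarrow>\<^bsub>G\<^esub> v \<longrightarrow> (u \<in> A \<and> v \<in> B) \<or> (u \<in> B \<and> v \<in> A)))"

definition induced_cycle :: "('a, 'b) pre_digraph \<Rightarrow> 'a list \<Rightarrow> bool" where
  "induced_cycle G cs \<longleftrightarrow> length cs \<ge> 3 \<and> distinct cs \<and> set cs \<subseteq> verts G \<and>
     (\<forall>i < length cs. \<forall>j < length cs.
        cs ! i \<rightarrow>\<^bsub>G\<^esub> cs ! j \<longleftrightarrow> j = Suc i mod length cs \<or> i = Suc j mod length cs)"

definition chordal_bipartite :: "('a, 'b) pre_digraph \<Rightarrow> bool" where
  "chordal_bipartite G \<longleftrightarrow>
     graph G \<and> bipartite G \<and> \<not> (\<exists>cs. length cs \<ge> 6 \<and> induced_cycle G cs)"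

definition total_dominating_set :: "('a, 'b) pre_digraph \<Rightarrow> 'a set \<Rightarrow> bool" where
  "total_dominating_set G S \<longleftrightarrow>
     S \<subseteq> verts G \<and> (\<forall>v \<in> verts G. neighbors G v \<inter> S \<noteq> {})"

text \<open>Meaningful only if \<open>no_isolated G\<close>: otherwise there is no total dominating set.\<close>

definition total_domination_number :: "('a, 'b) pre_digraph \<Rightarrow> nat" where
  "total_domination_number G = (LEAST k. \<exists>S. total_dominating_set G S \<and> card S = k)"

definition cd_coloring :: "('a, 'b) pre_digraph \<Rightarrow> ('a \<Rightarrow> nat) \<Rightarrow> bool" where
  "cd_coloring G f \<longleftrightarrow>
     (\<forall>u \<in> verts G. \<forall>v \<in> verts G. u \<rightarrow>\<^bsub>G\<^esub> v \<longrightarrow> f u \<noteq> f v) \<and>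
     (\<forall>c \<in> f ` verts G. \<exists>v \<in> verts G. {u \<in> verts G. f u = c} \<subseteq> insert v (neighbors G v))"

definition cd_chromatic_number :: "('a, 'b) pre_digraph \<Rightarrow> nat" where
  "cd_chromatic_number G = (LEAST k. \<exists>f. cd_coloring G f \<and> card (f ` verts G) = k)"

text \<open>
  With unit weights, \<open>wf_digraph.\<mu>\<close> is the usual distance (infinite between different components).
\<close>

definition separated_cluster :: "('a, 'b) pre_digraph \<Rightarrow> 'a set \<Rightarrow> bool" where
  "separated_cluster G S \<longleftrightarrow> S \<subseteq> verts G \<and>
     (\<forall>u \<in> S. \<forall>v \<in> S. wf_digraph.\<mu> G (\<lambda>_. 1) u v \<noteq> 2)"

definition separated_cluster_number :: "('a, 'b) pre_digraph \<Rightarrow> nat" where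
  "separated_cluster_number G = Max {card S | S. separated_cluster G S}"

definition cd_perfect :: "('a, 'b) pre_digraph \<Rightarrow> bool" where
  "cd_perfect G \<longleftrightarrow>
     (\<forall>H. induced_subgraph H G \<longrightarrow> cd_chromatic_number H = separated_cluster_number H)"


section \<open>Word RAM\<close>

text \<open>
  Running time is measured on a word RAM that is programmed in a while language. A program uses
  finitely many named arrays of natural numbers; the cell with index 0 serves as a scalar
  variable. Each operation, constant and memory access costs one step. In return, every value that
  occurs in a computation, including every intermediate result and every array index, must stay
  below the bound \<open>W\<close>; otherwise the computation is stuck, so that no \<open>exec\<close> derivation exists.
\<close>

type_synonym state = "string \<Rightarrow> nat \<Rightarrow> nat"

datatype exp =
    Const nat
  | Cell string exp
  | Plus exp exp
  | Minus exp exp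
  | Times exp exp

primrec val :: "exp \<Rightarrow> state \<Rightarrow> nat" where
  "val (Const k) s = k"
| "val (Cell x i) s = s x (val i s)"
| "val (Plus a b) s = val a s + val b s"
| "val (Minus a b) s = val a s - val b s"
| "val (Times a b) s = val a s * val b s"

primrec cost :: "exp \<Rightarrow> nat" where
  "cost (Const k) = 1"
| "cost (Cell x i) = 1 + cost i"
| "cost (Plus a b) = 1 + cost a + cost b"
| "cost (Minus a b) = 1 + cost a + cost b"
| "cost (Times a b) = 1 + cost a + cost b"

primrec fits :: "nat \<Rightarrow> exp \<Rightarrow> state \<Rightarrow> bool" where
  "fits W (Const k) s \<longleftrightarrow> k < W"
| "fits W (Cell x i) s \<longleftrightarrow> fits W i s \<and> s x (val i s) < W"
| "fits W (Plus a b) s \<longleftrightarrow> fits W a s \<and> fits W b s \<and> val a s + val b s < W"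
| "fits W (Minus a b) s \<longleftrightarrow> fits W a s \<and> fits W b s"
| "fits W (Times a b) s \<longleftrightarrow> fits W a s \<and> fits W b s \<and> val a s * val b s < W"

datatype com =
    Skip
  | Assign string exp exp
  | Seq com com
  | If exp com com
  | While exp com

text \<open>
  \<open>exec W c s t s'\<close>: started in \<open>s\<close>, the program \<open>c\<close> halts in \<open>s'\<close> after exactly \<open>t\<close> steps.
  A test succeeds if its value is nonzero.
\<close>

inductive exec :: "nat \<Rightarrow> com \<Rightarrow> state \<Rightarrow> nat \<Rightarrow> state \<Rightarrow> bool" for W :: nat where
  Skip: "exec W Skip s 1 s"
| Assign: "fits W i s \<Longrightarrow> fits W a s \<Longrightarrow>
    exec W (Assign x i a) s (1 + cost i + cost a) (s(x := (s x)(val i s := val a s)))"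
| Seq: "exec W c1 s t1 s' \<Longrightarrow> exec W c2 s' t2 s'' \<Longrightarrow> exec W (Seq c1 c2) s (t1 + t2) s''"
| IfTrue: "fits W b s \<Longrightarrow> val b s \<noteq> 0 \<Longrightarrow> exec W c1 s t s' \<Longrightarrow>
    exec W (If b c1 c2) s (1 + cost b + t) s'"
| IfFalse: "fits W b s \<Longrightarrow> val b s = 0 \<Longrightarrow> exec W c2 s t s' \<Longrightarrow>
    exec W (If b c1 c2) s (1 + cost b + t) s'"
| WhileFalse: "fits W b s \<Longrightarrow> val b s = 0 \<Longrightarrow> exec W (While b c) s (1 + cost b) s"
| WhileTrue: "fits W b s \<Longrightarrow> val b s \<noteq> 0 \<Longrightarrow> exec W c s t1 s' \<Longrightarrow> exec W (While b c) s' t2 s'' \<Longrightarrow>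
    exec W (While b c) s (1 + cost b + t1 + t2) s''"

text \<open>
  A graph with vertices \<open>0, \<dots>, n - 1\<close> is given by \<open>n\<close> and its adjacency matrix, row by row. All
  other cells are initially 0.
\<close>

definition graph_input :: "(nat, 'b) pre_digraph \<Rightarrow> state" where
  "graph_input G = (let n = card (verts G) in (\<lambda>_ _. 0)
     (''n'' := (\<lambda>_. 0)(0 := n),
      ''adj'' := (\<lambda>k. if k < n * n \<and> (k div n) \<rightarrow>\<^bsub>G\<^esub> (k mod n) then 1 else 0)))"

text \<open>
  A single program has to compute the parameter \<open>f\<close> on all graphs of the class \<open>P\<close>, with words
  of \<open>O(log n)\<close> bits, i.e. word bound \<open>(n + 2) ^ d\<close> for a constant \<open>d\<close>.
\<close>

definition solvable_in_time ::
  "((nat, nat \<times> nat) pre_digraph \<Rightarrow> bool) \<Rightarrow> ((nat, nat \<times> nat) pre_digraph \<Rightarrow> nat) \<Rightarrow>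
   (nat \<Rightarrow> real) \<Rightarrow> bool" where
  "solvable_in_time P f g \<longleftrightarrow> (\<exists>p d. \<exists>T :: nat \<Rightarrow> nat. (\<lambda>n. real (T n)) \<in> O(g) \<and>
     (\<forall>n G. P G \<and> verts G = {..<n} \<longrightarrow>
        (\<exists>t s. exec ((n + 2) ^ d) p (graph_input G) t s \<and> t \<le> T n \<and> s ''out'' 0 = f G)))"

end

theory Submission
  imports Defs
begin

text \<open>
  Call a vertex \<open>c\<close> a column if it is used to cover and a row if it is to be covered. Maximum
  cardinality search always picks next an unused column with the most neighbours among the rows
  already covered, and covers all its neighbours. For a graph without long holes the resulting
  order has the following property: if \<open>y\<close> is first covered by the column \<open>c\<close>, then \<open>c\<close> is adjacent
  to every row \<open>x\<close> that is covered by then and has a common neighbour with \<open>y\<close>.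

  Now go through the columns backwards and keep a column iff it is the first cover of some row
  that the columns kept so far do not dominate. The kept columns dominate all non-isolated
  vertices, and by the property their witnesses pairwise have no common neighbour. Hence the
  number of kept columns is both the size of a total dominating set and the size of a separated
  cluster, and weak duality makes both optimal. An isolated vertex adds one colour and one member
  of the cluster.
  Every row is covered for the first time only once, so the search takes quadratic time.
\<close>


section \<open>Maximum cardinality search\<close>

text \<open>Rows and columns are those of the adjacency matrix, so every vertex is both. A column on
  one side of the bipartition covers rows of the other side only; the search therefore runs on the
  whole vertex set, without knowing a bipartition and without treating components separately. The
  2-colouring enters only through parity arguments.

  Covering all rows by columns and packing rows without a common column are dual integer programs.
  Absence of long holes means that the matrix is totally balanced, and the order is the elimination
  order from which optimal solutions of both programs are read off together. The hard part is the
  property of the order. The selection rule compares mere cardinalities, and all that is extracted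
  from it is one exchange between two columns; this is iterated along induced paths by descent on
  the position in the order.

  Isolated vertices cannot be excluded at the outset, because an induced subgraph may have them even
  if the graph has none.\<close>

definition marked :: "('a \<Rightarrow> 'a \<Rightarrow> bool) \<Rightarrow> (nat \<Rightarrow> 'a) \<Rightarrow> nat \<Rightarrow> 'a set" where
  "marked E c k = {r. \<exists>i<k. E (c i) r}"

definition mcs_order :: "'a set \<Rightarrow> ('a \<Rightarrow> 'a \<Rightarrow> bool) \<Rightarrow> nat \<Rightarrow> (nat \<Rightarrow> 'a) \<Rightarrow> bool" where
  "mcs_order V E k c \<longleftrightarrow> inj_on c {..<k} \<and> c ` {..<k} \<subseteq> V \<and>
     (\<forall>t<k. \<forall>v \<in> V - c ` {..<t}.
        card {r \<in> marked E c t. E v r} \<le> card {r \<in> marked E c t. E (c t) r})"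

text \<open>The condition is recursive but well founded: membership of \<open>k\<close> depends only
  on members above \<open>k\<close>, so \<open>K\<close> is determined from the top down. The lower
  end \<open>m\<close> is a parameter so that an unfinished backward pass satisfies the same
  predicate.\<close>

definition greedy_choice :: "('a \<Rightarrow> 'a \<Rightarrow> bool) \<Rightarrow> (nat \<Rightarrow> 'a) \<Rightarrow> nat \<Rightarrow> nat \<Rightarrow> nat set \<Rightarrow> bool" where
  "greedy_choice E c m n K \<longleftrightarrow> K \<subseteq> {m..<n} \<and>
     (\<forall>k \<in> {m..<n}. k \<in> K \<longleftrightarrow>
        (\<exists>r. E (c k) r \<and> r \<notin> marked E c k \<and> (\<forall>k' \<in> K. k < k' \<longrightarrow> \<not> E (c k') r)))"

definition induced_path :: "('a \<Rightarrow> 'a \<Rightarrow> bool) \<Rightarrow> 'a list \<Rightarrow> bool" where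
  "induced_path E p \<longleftrightarrow> distinct p \<and>
     (\<forall>i<length p. \<forall>j<length p. E (p ! i) (p ! j) \<longleftrightarrow> j = Suc i \<or> i = Suc j)"

section \<open>Partial search orders and partial backward passes\<close>

lemma marked_mono: "s \<le> t \<Longrightarrow> marked E c s \<subseteq> marked E c t"
  by (force simp: marked_def)

lemma marked_Suc: "marked E c (Suc k) = marked E c k \<union> {r. E (c k) r}"
  by (auto simp: marked_def less_Suc_eq)

lemma marked_0 [simp]: "marked E c 0 = {}"
  by (simp add: marked_def)

lemma marked_cong: "(\<And>i. i < k \<Longrightarrow> c i = c' i) \<Longrightarrow> marked E c k = marked E c' k"
  by (auto simp: marked_def)

text \<open>Changing \<open>c\<close> at \<open>k\<close> affects neither images nor marked sets of
  the stages up to \<open>k\<close>, so only the choice at stage \<open>k\<close> has to be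
  justified. Both the existence proof and the loop invariant of the program rest on this
  step.\<close>

lemma mcs_order_Suc:
  assumes "mcs_order V E k c" "v \<in> V - c ` {..<k}"
    and "\<And>u. u \<in> V - c ` {..<k} \<Longrightarrow>
      card {r \<in> marked E c k. E u r} \<le> card {r \<in> marked E c k. E v r}"
  shows "mcs_order V E (Suc k) (c(k := v))"
proof -
  have img: "(c(k := v)) ` {..<t} = c ` {..<t}" if "t \<le> k" for t
    using that by (intro image_cong) auto
  have mk: "marked E (c(k := v)) t = marked E c t" if "t \<le> k" for t
    using that by (intro marked_cong) auto
  have "inj_on (c(k := v)) {..<Suc k}"
    using assms(1,2) by (auto simp: mcs_order_def inj_on_def less_Suc_eq)
  moreover have "(c(k := v)) ` {..<Suc k} \<subseteq> V"
    using assms(1,2) by (auto simp: mcs_order_def less_Suc_eq)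
  moreover have "\<forall>t<Suc k. \<forall>u \<in> V - (c(k := v)) ` {..<t}.
      card {r \<in> marked E (c(k := v)) t. E u r}
      \<le> card {r \<in> marked E (c(k := v)) t. E ((c(k := v)) t) r}"
  proof (intro allI impI)
    fix t assume "t < Suc k"
    then consider "t < k" | "t = k" by linarith
    then show "\<forall>u \<in> V - (c(k := v)) ` {..<t}.
      card {r \<in> marked E (c(k := v)) t. E u r}
      \<le> card {r \<in> marked E (c(k := v)) t. E ((c(k := v)) t) r}"
    proof cases
      case 1
      then show ?thesis using assms(1) img[of t] mk[of t] unfolding mcs_order_def by auto
    next
      case 2
      then show ?thesis using assms(3) img[of t] mk[of t] by auto
    qed
  qed
  ultimately show ?thesis unfolding mcs_order_def by blast
qed

text \<open>Perfection and duality concern arbitrary vertex types, so an order has to exist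
  independently of the program.\<close>

lemma mcs_order_exists:
  assumes "finite V" "k \<le> card V"
  shows "\<exists>c. mcs_order V E k c"
  using assms(2)
proof (induction k)
  case 0
  then show ?case by (auto simp: mcs_order_def)
next
  case (Suc k)
  then obtain c where c: "mcs_order V E k c" by auto
  let ?f = "\<lambda>u. card {r \<in> marked E c k. E u r}"
  have "card (c ` {..<k}) \<le> k" using card_image_le[of "{..<k}" c] by simp
  then have "\<not> V \<subseteq> c ` {..<k}" using Suc.prems card_mono[of "c ` {..<k}" V] by auto
  then have ne: "V - c ` {..<k} \<noteq> {}" by auto
  have fin: "finite (V - c ` {..<k})" using assms(1) by auto
  have "Max (?f ` (V - c ` {..<k})) \<in> ?f ` (V - c ` {..<k})"
    using fin ne by (intro Max_in) auto
  then obtain v where "v \<in> V - c ` {..<k}" "?f v = Max (?f ` (V - c ` {..<k}))" by auto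
  then have "mcs_order V E (Suc k) (c(k := v))"
    using fin by (intro mcs_order_Suc[OF c]) auto
  then show ?case by blast
qed

text \<open>Adding \<open>m\<close> cannot disturb decisions already taken, because the condition at
  \<open>k\<close> looks only at members above \<open>k\<close>. The loop of the program reuses this
  single step.\<close>

lemma greedy_choice_Suc:
  assumes "greedy_choice E c (Suc m) n K" "m < n"
  shows "greedy_choice E c m n
    (if \<exists>r. E (c m) r \<and> r \<notin> marked E c m \<and> (\<forall>k \<in> K. \<not> E (c k) r) then insert m K else K)"
    (is "greedy_choice E c m n (if ?P then _ else _)")
proof -
  let ?K = "if ?P then insert m K else K"
  have sub: "K \<subseteq> {Suc m..<n}" and K: "\<And>k. k \<in> {Suc m..<n} \<Longrightarrow> k \<in> K \<longleftrightarrow>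
        (\<exists>r. E (c k) r \<and> r \<notin> marked E c k \<and> (\<forall>k' \<in> K. k < k' \<longrightarrow> \<not> E (c k') r))"
    using assms(1) unfolding greedy_choice_def by auto
  have gr: "(\<forall>k' \<in> ?K. k < k' \<longrightarrow> P k') \<longleftrightarrow> (\<forall>k' \<in> K. k < k' \<longrightarrow> P k')" if "m \<le> k" for k P
    using that by auto
  have "?K \<subseteq> {m..<n}" using sub assms(2) by auto
  moreover have "k \<in> ?K \<longleftrightarrow>
        (\<exists>r. E (c k) r \<and> r \<notin> marked E c k \<and> (\<forall>k' \<in> ?K. k < k' \<longrightarrow> \<not> E (c k') r))"
    if k: "k \<in> {m..<n}" for k
  proof (cases "k = m")
    case True
    have "m \<notin> K" "\<And>k'. k' \<in> K \<Longrightarrow> m < k'" using sub by force+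
    then show ?thesis using True by auto
  next
    case False
    then have "k \<in> ?K \<longleftrightarrow> k \<in> K" by auto
    also have "\<dots> \<longleftrightarrow> (\<exists>r. E (c k) r \<and> r \<notin> marked E c k \<and> (\<forall>k' \<in> K. k < k' \<longrightarrow> \<not> E (c k') r))"
      using K[of k] k False by auto
    also have "\<dots> \<longleftrightarrow> (\<exists>r. E (c k) r \<and> r \<notin> marked E c k \<and> (\<forall>k' \<in> ?K. k < k' \<longrightarrow> \<not> E (c k') r))"
      using k by (subst gr) auto
    finally show ?thesis .
  qed
  ultimately show ?thesis unfolding greedy_choice_def by blast
qed

lemma greedy_choice_exists: "\<exists>K. greedy_choice E c 0 n K"
proof -
  have "m \<le> n \<Longrightarrow> \<exists>K. greedy_choice E c m n K" for m
  proof (induction rule: inc_induct)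
    case base
    then show ?case by (auto simp: greedy_choice_def)
  next
    case (step m)
    then obtain K where "greedy_choice E c (Suc m) n K" by blast
    from greedy_choice_Suc[OF this step.hyps(2)] show ?case by blast
  qed
  then show ?thesis by simp
qed

text \<open>Reduces the digraph to its adjacency relation. \<open>side\<close> is any map that
  separates the two ends of every edge.\<close>

locale bipartite_no_long_hole =
  fixes V :: "'a set" and E :: "'a \<Rightarrow> 'a \<Rightarrow> bool" and side :: "'a \<Rightarrow> bool"
  assumes finite_V: "finite V"
    and sym: "E u v \<Longrightarrow> E v u"
    and adj_in_V: "E u v \<Longrightarrow> u \<in> V"
    and side: "E u v \<Longrightarrow> side u \<longleftrightarrow> \<not> side v"
    and no_hole: "\<lbrakk>6 \<le> length cs; distinct cs; set cs \<subseteq> V\<rbrakk> \<Longrightarrow>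
      \<not> (\<forall>i < length cs. \<forall>j < length cs.
        E (cs ! i) (cs ! j) \<longleftrightarrow> j = Suc i mod length cs \<or> i = Suc j mod length cs)"
begin

lemma finite_nbr [simp]: "finite {r. E v r}"
  by (rule finite_subset[OF _ finite_V]) (auto dest: sym adj_in_V)

lemma finite_marked [simp]: "finite (marked E c k)"
  by (rule finite_subset[OF _ finite_V]) (auto simp: marked_def dest: sym adj_in_V)

section \<open>Induced paths and their closure to holes\<close>

lemma induced_path_rev: "induced_path E p \<Longrightarrow> induced_path E (rev p)"
proof -
  assume p: "induced_path E p"
  have "E (rev p ! i) (rev p ! j) \<longleftrightarrow> j = Suc i \<or> i = Suc j"
    if "i < length p" "j < length p" for i j
  proof -
    have "E (rev p ! i) (rev p ! j) \<longleftrightarrow> E (p ! (length p - Suc i)) (p ! (length p - Suc j))"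
      using that by (simp add: rev_nth)
    also have "\<dots> \<longleftrightarrow> length p - Suc j = Suc (length p - Suc i)
        \<or> length p - Suc i = Suc (length p - Suc j)"
      using p that unfolding induced_path_def by simp
    finally show ?thesis using that by linarith
  qed
  then show ?thesis using p unfolding induced_path_def by simp
qed

lemma induced_path_take: "induced_path E p \<Longrightarrow> induced_path E (take m p)"
  unfolding induced_path_def by auto

lemma induced_path_snoc:
  assumes "induced_path E p" "p \<noteq> []" "z \<notin> set p" "E (last p) z"
    and "\<And>i. Suc i < length p \<Longrightarrow> \<not> E (p ! i) z"
  shows "induced_path E (p @ [z])"
proof -
  have zz: "\<not> E z z" using side by blast
  have adj: "E (p ! i) z \<longleftrightarrow> Suc i = length p" if "i < length p" for i
    using assms(2,4,5) that by (metis Suc_lessI diff_Suc_1 last_conv_nth less_irrefl)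
  then have adj': "E z (p ! i) \<longleftrightarrow> Suc i = length p" if "i < length p" for i
    using sym that by blast
  show ?thesis
    using assms(1,3) adj adj' zz unfolding induced_path_def
    by (auto simp: nth_append less_Suc_eq)
qed

lemma induced_path_side:
  assumes "induced_path E p" "i < length p"
  shows "side (p ! i) \<longleftrightarrow> (side (p ! 0) \<longleftrightarrow> even i)"
  using assms(2)
proof (induction i)
  case (Suc i)
  then have "E (p ! i) (p ! Suc i)" using assms(1) unfolding induced_path_def by auto
  then show ?case using Suc side by auto
qed simp

text \<open>The vertex \<open>g\<close> sees only the two ends, so \<open>p @ [g]\<close> is an
  induced cycle; five path vertices are just enough for length 6.\<close>

lemma induced_path_close:
  assumes p: "induced_path E p" and len: "5 \<le> length p"
    and g: "E g (p ! 0)" "E g (last p)"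
    and ng: "\<And>i. 0 < i \<Longrightarrow> Suc i < length p \<Longrightarrow> \<not> E g (p ! i)"
  shows False
proof -
  have E: "\<And>i j. i < length p \<Longrightarrow> j < length p \<Longrightarrow>
      E (p ! i) (p ! j) \<longleftrightarrow> j = Suc i \<or> i = Suc j"
    using p unfolding induced_path_def by blast
  have last: "last p = p ! (length p - 1)" using len by (intro last_conv_nth) auto
  \<comment> \<open>A path vertex adjacent to both ends would have index 1 and also index
    \<open>length p - 2\<close>, which forces a path of only 3 vertices.\<close>
  have gp: "g \<notin> set p"
  proof
    assume "g \<in> set p"
    then obtain i where i: "i < length p" "g = p ! i" by (auto simp: in_set_conv_nth)
    have "length p - 1 < length p" "0 < length p" using len by auto
    then have "i = 1" "length p - 1 = Suc i \<or> i = length p"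
      using E[of i 0] E[of i "length p - 1"] g i last by auto
    then show False using len by auto
  qed
  have adj: "E g (p ! i) \<longleftrightarrow> i = 0 \<or> Suc i = length p" if "i < length p" for i
    using g ng[of i] last that len
    by (metis Suc_lessI diff_Suc_1 neq0_conv)
  have adj': "E (p ! i) g \<longleftrightarrow> i = 0 \<or> Suc i = length p" if "i < length p" for i
    using adj[OF that] sym by blast
  have gg: "\<not> E g g" using side by blast
  let ?cs = "p @ [g]"
  have "set p \<subseteq> V"
  proof
    fix v assume "v \<in> set p"
    then obtain i where i: "i < length p" "v = p ! i" by (auto simp: in_set_conv_nth)
    then have "\<exists>j<length p. E (p ! i) (p ! j)"
      using E[of i "Suc i"] E[of i "i - 1"] len
      by (cases "Suc i < length p") (auto intro: exI[of _ "i - 1"])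
    then show "v \<in> V" using adj_in_V i by auto
  qed
  then have "set ?cs \<subseteq> V" using adj_in_V g by auto
  moreover have "distinct ?cs" using p gp unfolding induced_path_def by auto
  moreover have "E (?cs ! i) (?cs ! j) \<longleftrightarrow>
      j = Suc i mod length ?cs \<or> i = Suc j mod length ?cs"
    if ij: "i < length ?cs" "j < length ?cs" for i j
  proof -
    have m: "Suc k mod length ?cs = (if k = length p then 0 else Suc k)"
      if "k < length ?cs" for k using that by auto
    consider "i < length p" "j < length p" | "i = length p" "j < length p"
      | "i < length p" "j = length p" | "i = length p" "j = length p"
      using ij unfolding length_append_singleton less_Suc_eq by blast
    then show ?thesis
    proof cases
      case 1
      then show ?thesis using E m[of i] m[of j] by (auto simp: nth_append)
    next
      case 2
      then show ?thesis using adj[of j] m[of i] m[of j] by (auto simp: nth_append)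
    next
      case 3
      then show ?thesis using adj'[of i] m[of i] m[of j] by (auto simp: nth_append)
    next
      case 4
      then show ?thesis using gg m[of i] len by (auto simp: nth_append)
    qed
  qed
  moreover have "6 \<le> length ?cs" using len by simp
  ultimately show False using no_hole by blast
qed

lemma mcs_order_exchange:
  assumes "mcs_order V E n c" "b < n" "v \<in> V - c ` {..<b}"
    and "x \<in> marked E c b" "E v x" "\<not> E (c b) x"
  shows "\<exists>z \<in> marked E c b. E (c b) z \<and> \<not> E v z"
proof (rule ccontr)
  assume "\<not> ?thesis"
  then have "{r \<in> marked E c b. E (c b) r} \<subset> {r \<in> marked E c b. E v r}"
    using assms(4-6) by blast
  then have "card {r \<in> marked E c b. E (c b) r} < card {r \<in> marked E c b. E v r}"
    by (intro psubset_card_mono) auto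
  moreover have "card {r \<in> marked E c b. E v r} \<le> card {r \<in> marked E c b. E (c b) r}"
    using assms(1-3) unfolding mcs_order_def by blast
  ultimately show False by simp
qed

text \<open>
  Such a path is either closed to a long hole by an early vertex of the order, or the selection
  rule prolongs it to a path of the same kind for a smaller \<open>t\<close>.
\<close>

lemma no_late_induced_path:
  assumes "mcs_order V E n c" "t < n" "induced_path E p" "odd (length p)" "5 \<le> length p"
    and "p ! 0 \<in> marked E c (Suc t)" "last p \<in> marked E c (Suc t)"
    and "\<And>i. even i \<Longrightarrow> 0 < i \<Longrightarrow> Suc i < length p \<Longrightarrow> p ! i \<notin> marked E c (Suc t)"
    and "\<And>i. odd i \<Longrightarrow> i < length p \<Longrightarrow> p ! i \<notin> c ` {..t}"
  shows False
  using assms(2-)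
proof (induction t arbitrary: p rule: less_induct)
  case (less t)
  note mcs = assms(1)
  \<comment> \<open>The case in which the last row is first covered by \<open>c b\<close> and
    \<open>c b\<close> misses the first row. It is stated for an arbitrary \<open>p\<close> because
    it is applied to the given path and to its reversal.\<close>
  have step: False
    if p: "induced_path E p" "odd (length p)" "5 \<le> length p"
      and ends: "p ! 0 \<in> marked E c b" "last p \<notin> marked E c b" "E (c b) (last p)" "b \<le> t"
      and inner: "\<And>i. even i \<Longrightarrow> 0 < i \<Longrightarrow> Suc i < length p \<Longrightarrow> p ! i \<notin> marked E c (Suc t)"
      and cols: "\<And>i. odd i \<Longrightarrow> i < length p \<Longrightarrow> p ! i \<notin> c ` {..t}"
      and nc: "\<not> E (c b) (p ! 0)"
    for p b
  proof -
    let ?e = "c b" and ?m = "length p"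
    have E: "\<And>i j. i < ?m \<Longrightarrow> j < ?m \<Longrightarrow> E (p ! i) (p ! j) \<longleftrightarrow> j = Suc i \<or> i = Suc j"
      using p(1) unfolding induced_path_def by blast
    have last: "last p = p ! (?m - 1)" using p(3) by (intro last_conv_nth) auto
    have E10: "E (p ! 1) (p ! 0)"
    proof -
      have "1 < ?m" "0 < ?m" using p(3) by linarith+
      then show ?thesis using E[of 1 0] by simp
    qed
    have "p ! 1 \<in> V - c ` {..<b}" using adj_in_V[OF E10] cols[of 1] p(3) ends(4) by force
    then obtain z where z: "z \<in> marked E c b" "E ?e z" "\<not> E (p ! 1) z"
      using mcs_order_exchange[OF mcs, of b "p ! 1" "p ! 0"] E10 ends nc less.prems(1) by auto
    have side_p: "side (p ! i) \<longleftrightarrow> (side (p ! 0) \<longleftrightarrow> even i)" if "i < ?m" for i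
      using induced_path_side[OF p(1) that] .
    have side_e: "side ?e \<longleftrightarrow> \<not> side (p ! 0)"
      using side[OF ends(3)] side_p[of "?m - 1"] last p(2,3) by auto
    have side_z: "side z \<longleftrightarrow> side (p ! 0)" using side_e side[OF z(2)] by auto
    have ep: "?e \<noteq> p ! i" if "i < ?m" for i
    proof (cases "even i")
      case True
      then show ?thesis using side_e side_p[OF that] by auto
    next
      case False
      then show ?thesis using cols[OF False that] ends(4) by (metis atMost_iff image_eqI)
    qed
    have nep: "\<not> E ?e (p ! i)" if "Suc i < ?m" for i
    proof (cases "even i")
      case True
      show ?thesis
      proof (cases "i = 0")
        case False
        then show ?thesis using inner[of i] True that ends(4) unfolding marked_def by auto
      qed (use nc in simp)
    next
      case False
      then show ?thesis using side[of ?e "p ! i"] side_e side_p[of i] that by auto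
    qed
    have "?e \<notin> set p" using ep by (metis in_set_conv_nth)
    then have ipq: "induced_path E (p @ [?e])"
      using p(1,3) nep ends(3) sym by (intro induced_path_snoc) auto
    \<comment> \<open>The path vertices on the side of \<open>z\<close> are the interior rows,
      uncovered through time \<open>t\<close>, the last row, uncovered before \<open>b\<close>, and
      \<open>p ! 0\<close>, which \<open>c b\<close> misses. None of them can be
      \<open>z\<close>.\<close>
    have zp: "z \<noteq> p ! i" if "i < ?m" for i
    proof
      assume zi: "z = p ! i"
      then have ev: "even i" using side_z side_p[OF that] by auto
      have "z \<notin> marked E c b" if "0 < i" "Suc i < ?m"
        using inner[of i] ev that zi marked_mono[of b "Suc t" E c] ends(4) by auto
      moreover have "z = last p" if "Suc i = ?m"
        using zi last by (simp flip: that)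
      ultimately show False using zi z nc ends(2) that
        by (metis Suc_lessI neq0_conv)
    qed
    define q where "q = p @ [?e]"
    have lq: "length q = Suc ?m" and qm: "q ! ?m = ?e" and qp: "\<And>i. i < ?m \<Longrightarrow> q ! i = p ! i"
      unfolding q_def by (auto simp: nth_append)
    \<comment> \<open>The first vertex of the prolonged path that sees \<open>z\<close>: cutting
      there keeps the path induced. The index is odd because \<open>z\<close> lies on the side of
      the even positions, and it is not 1 by the choice of \<open>z\<close>; hence the new path has
      odd length at least 5.\<close>
    define i where "i = (LEAST i. i \<le> ?m \<and> E (q ! i) z)"
    have i: "i \<le> ?m" "E (q ! i) z"
      using LeastI[of "\<lambda>i. i \<le> ?m \<and> E (q ! i) z" ?m] qm z(2) unfolding i_def by auto
    have i_least: "\<not> E (q ! j) z" if "j < i" for j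
      using not_less_Least[of j "\<lambda>i. i \<le> ?m \<and> E (q ! i) z"] that i(1) unfolding i_def by auto
    have side_q: "side (q ! j) \<longleftrightarrow> (side (p ! 0) \<longleftrightarrow> even j)" if "j \<le> ?m" for j
      using that side_p[of j] side_e p(2) qm qp[of j] by (cases "j = ?m") auto
    have odd_i: "odd i" using side[OF i(2)] side_z side_q[OF i(1)] by auto
    have "i \<noteq> 1" using i(2) z(3) qp[of 1] p(3) by auto
    with odd_i have i3: "3 \<le> i" by presburger
    define r where "r = take (Suc i) q @ [z]"
    have lr: "length r = i + 2" unfolding r_def using lq i(1) by simp
    have rq: "r ! j = q ! j" if "j \<le> i" for j
      using that lq i(1) unfolding r_def by (auto simp: nth_append)
    have lastr: "last r = z" unfolding r_def by simp
    have "z \<notin> set q" using zp side[OF z(2)] unfolding q_def by (auto simp: in_set_conv_nth)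
    then have zt: "z \<notin> set (take (Suc i) q)" by (meson in_set_takeD)
    have ipr: "induced_path E r"
      unfolding r_def
    proof (rule induced_path_snoc)
      show "induced_path E (take (Suc i) q)" using ipq induced_path_take unfolding q_def by blast
      show "take (Suc i) q \<noteq> []" using lq by auto
      have "last (take (Suc i) q) = q ! i"
        using lq i(1) by (simp add: take_Suc_conv_app_nth)
      then show "E (last (take (Suc i) q)) z" using i(2) by simp
      show "\<not> E (take (Suc i) q ! j) z" if "Suc j < length (take (Suc i) q)" for j
        using that i_least[of j] lq by auto
    qed (fact zt)
    \<comment> \<open>\<open>p ! 0\<close> is covered before \<open>b\<close>, so \<open>b\<close>
      is positive and the descent may go to \<open>b - 1\<close>, where the covered rows are those
      of \<open>marked E c b\<close>.\<close>
    have b0: "0 < b" using ends(1) by (cases b) auto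
    then have Sb: "Suc (b - 1) = b" by simp
    show False
    proof (rule less.IH[of "b - 1" r])
      show "b - 1 < t" using b0 ends(4) by linarith
      show "b - 1 < n" using less.prems(1) ends(4) by linarith
      show "induced_path E r" by (fact ipr)
      show "odd (length r)" "5 \<le> length r" using lr odd_i i3 by auto
      show "r ! 0 \<in> marked E c (Suc (b - 1))" using rq[of 0] qp[of 0] p(3) ends(1) Sb by (cases p) auto
      show "last r \<in> marked E c (Suc (b - 1))" using lastr z(1) Sb by simp
      show "r ! j \<notin> marked E c (Suc (b - 1))" if "even j" "0 < j" "Suc j < length r" for j
      proof -
        have "j \<noteq> i" using odd_i that(1) by auto
        then have j: "j < i" using that(3) lr by auto
        then have rj: "r ! j = p ! j" using rq[of j] qp[of j] i(1) by auto
        \<comment> \<open>If the cut is at \<open>c b\<close> itself, the former last row becomes an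
          interior one. It is uncovered before \<open>b\<close>, since \<open>c b\<close> is its
          first cover.\<close>
        show ?thesis
        proof (cases "Suc j = ?m")
          case True
          then have "p ! j = last p" using last by (simp flip: True)
          then show ?thesis using rj ends(2) Sb by auto
        next
          case False
          then show ?thesis
            using inner[of j] that rj j i(1) marked_mono[of b "Suc t" E c] ends(4) Sb by auto
        qed
      qed
      show "r ! j \<notin> c ` {..b - 1}" if "odd j" "j < length r" for j
      proof -
        have "j \<noteq> Suc i" using odd_i that(1) by auto
        then have j: "j \<le> i" using that(2) lr by auto
        show ?thesis
        proof (cases "j = ?m")
          case True
          have "inj_on c {..<n}" using mcs unfolding mcs_order_def by blast
          then have "c b \<notin> c ` {..b - 1}"
            using less.prems(1) ends(4) b0 by (fastforce simp: inj_on_def)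
          then show ?thesis using rq[OF j] True qm by auto
        next
          case False
          then have "r ! j = p ! j" "j < ?m" using rq[OF j] qp[of j] j i(1) by auto
          moreover have "{..b - 1} \<subseteq> {..t}" using ends(4) by auto
          ultimately show ?thesis using cols[OF that(1)] by (metis image_mono subsetD)
        qed
      qed
    qed
  qed
  define f where "f x = (LEAST i. E (c i) x)" for x
  have f: "E (c (f x)) x" "x \<notin> marked E c (f x)" "f x \<le> t" "\<And>k. f x < k \<Longrightarrow> x \<in> marked E c k"
    if x: "x \<in> marked E c (Suc t)" for x
  proof -
    obtain i where i: "i \<le> t" "E (c i) x"
      using x unfolding marked_def less_Suc_eq_le by auto
    show *: "E (c (f x)) x" using LeastI[of "\<lambda>i. E (c i) x" i] i unfolding f_def by auto
    show "x \<notin> marked E c (f x)" using not_less_Least unfolding f_def marked_def by blast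
    show "f x \<le> t" using Least_le[of "\<lambda>i. E (c i) x" i] i unfolding f_def by auto
    show "x \<in> marked E c k" if "f x < k" for k using that * unfolding marked_def by auto
  qed
  have last: "last p = p ! (length p - 1)" using less.prems(4) by (intro last_conv_nth) auto
  \<comment> \<open>An early column adjacent to both ends sees no interior row, as these are still
    uncovered, and no odd position, as these lie on its own side. It would close the path to a long
    hole, so the two ends have different first covers.\<close>
  have common: "\<not> (E (c s) (p ! 0) \<and> E (c s) (last p))" if "s \<le> t" for s
  proof
    assume s: "E (c s) (p ! 0) \<and> E (c s) (last p)"
    show False
    proof (rule induced_path_close[of p "c s"])
      show "\<not> E (c s) (p ! i)" if i: "0 < i" "Suc i < length p" for i
      proof (cases "even i")
        case True
        then show ?thesis using less.prems(7)[of i] i \<open>s \<le> t\<close> unfolding marked_def by auto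
      next
        case False
        then show ?thesis
          using side[of "c s" "p ! i"] side[of "c s" "p ! 0"] s
            induced_path_side[OF less.prems(2), of i] i by auto
      qed
    qed (use s less.prems in auto)
  qed
  note f0 = f[OF less.prems(5)] and f1 = f[OF less.prems(6)]
  show False
  proof (cases "f (p ! 0) < f (last p)")
    case True
    show ?thesis
    proof (rule step[of p "f (last p)"])
      show "p ! 0 \<in> marked E c (f (last p))" using f0(4) True .
      show "\<not> E (c (f (last p))) (p ! 0)" using common[of "f (last p)"] f1 by blast
    qed (fact f1 less.prems)+
  next
    case False
    then have lt: "f (last p) < f (p ! 0)"
      using common[of "f (last p)"] f0(1,3) f1(1,3) by (metis linorder_neqE_nat)
    have ne: "p \<noteq> []" using less.prems(4) by auto
    have hd: "hd p = p ! 0" using ne by (rule hd_conv_nth)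
    have rev0: "rev p ! 0 = last p" using ne last by (simp add: rev_nth)
    \<comment> \<open>Reversal swaps the ends, and since the length is odd it preserves the parity
      of positions, that is, the roles of rows and columns.\<close>
    show ?thesis
    proof (rule step[of "rev p" "f (p ! 0)"])
      show "rev p ! i \<notin> marked E c (Suc t)"
        if "even i" "0 < i" "Suc i < length (rev p)" for i
        using less.prems(7)[of "length p - Suc i"] that less.prems(3) by (auto simp: rev_nth)
      show "rev p ! i \<notin> c ` {..t}" if "odd i" "i < length (rev p)" for i
        using less.prems(8)[of "length p - Suc i"] that less.prems(3) by (auto simp: rev_nth)
      show "rev p ! 0 \<in> marked E c (f (p ! 0))" using f1(4)[OF lt] rev0 by simp
      show "\<not> E (c (f (p ! 0))) (rev p ! 0)" using common[of "f (p ! 0)"] f0 rev0 by auto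
      show "last (rev p) \<notin> marked E c (f (p ! 0))" "E (c (f (p ! 0))) (last (rev p))"
        using f0 ne hd by (auto simp: last_rev)
    qed (use f0(3) less.prems in \<open>auto simp: induced_path_rev\<close>)
  qed
qed

lemma mcs_order_dominates:
  assumes mcs: "mcs_order V E n c" "c ` {..<n} = V"
    and b: "b < n" "E (c b) y" "y \<notin> marked E c b"
    and x: "x \<in> marked E c (Suc b)"
    and w: "E w x" "E w y"
  shows "E (c b) x"
proof (rule ccontr)
  assume nx: "\<not> E (c b) x"
  have xb: "x \<in> marked E c b" using x nx by (auto simp: marked_Suc)
  obtain s where s: "s < n" "w = c s" using adj_in_V[OF w(1)] mcs(2) by auto
  have "\<not> s < b" using s(2) w(2) b(3) by (auto simp: marked_def)
  moreover have "s \<noteq> b" using s(2) w(1) nx by auto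
  ultimately have sb: "b < s" by simp
  have inj: "inj_on c {..<n}" using mcs(1) unfolding mcs_order_def by blast
  have wb: "w \<notin> c ` {..b}" using sb s inj by (fastforce simp: inj_on_def)
  then have "w \<in> V - c ` {..<b}" using adj_in_V[OF w(1)] by force
  then obtain z where z: "z \<in> marked E c b" "E (c b) z" "\<not> E w z"
    using mcs_order_exchange[OF mcs(1) b(1) _ xb w(1) nx] by auto
  let ?p = "[x, w, y, c b, z]"
  have b0: "0 < b" using xb by (cases b) auto
  have cb: "c b \<notin> c ` {..b - 1}" using b(1) b0 inj by (fastforce simp: inj_on_def)
  have ne: "x \<noteq> y" "z \<noteq> y" "x \<noteq> z" "w \<noteq> c b" using xb z b(3) w nx by auto
  have sides: "side x = side y" "side z = side y" "side w = (\<not> side y)" "side (c b) = (\<not> side y)"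
    using side[OF w(1)] side[OF w(2)] side[OF z(2)] side[OF b(2)] by auto
  have nadj: "\<not> E u v" if "side u = side v" for u v using that side by blast
  have adj: "E x w" "E y w" "E y (c b)" "E z (c b)" "\<not> E x (c b)" "\<not> E z w"
    using w z b nx sym by blast+
  have ip: "induced_path E ?p"
    unfolding induced_path_def
    using ne sides adj w z b nx nadj
    by (auto simp: less_Suc_eq numeral_eq_Suc)
  show False
  proof (rule no_late_induced_path[OF mcs(1) _ ip])
    show "b - 1 < n" using b by simp
    show "?p ! i \<notin> marked E c (Suc (b - 1))" if "even i" "0 < i" "Suc i < length ?p" for i
    proof -
      have "i = 2" using that by simp presburger
      then show ?thesis using b0 b(3) by simp
    qed
    show "?p ! i \<notin> c ` {..b - 1}" if "odd i" "i < length ?p" for i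
    proof -
      have "{..b - 1} \<subseteq> {..b}" by auto
      then have "w \<notin> c ` {..b - 1}" using wb by (meson image_mono subsetD)
      moreover have "i = 1 \<or> i = 3" using that by simp presburger
      ultimately show ?thesis using cb by auto
    qed
  qed (use xb z b0 in auto)
qed

text \<open>Let \<open>k < k'\<close> be kept, with witnesses \<open>r k\<close> and
  \<open>r k'\<close> that have a common neighbour. The ordering property at \<open>k'\<close> makes
  \<open>c k'\<close> adjacent to \<open>r k\<close>, although \<open>r k\<close> was chosen
  undominated by kept columns after \<open>k\<close>. With \<open>c k\<close> as the common
  neighbour the same argument shows that the witnesses are distinct.\<close>

lemma greedy_packing:
  assumes mcs: "mcs_order V E n c" "c ` {..<n} = V" and K: "greedy_choice E c 0 n K"
  obtains S where "card S = card K" "\<And>r. r \<in> S \<Longrightarrow> \<exists>v. E v r"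
    "\<And>r r' w. r \<in> S \<Longrightarrow> r' \<in> S \<Longrightarrow> E w r \<Longrightarrow> E w r' \<Longrightarrow> r = r'"
proof -
  have "\<exists>r. E (c k) r \<and> r \<notin> marked E c k \<and> (\<forall>k' \<in> K. k < k' \<longrightarrow> \<not> E (c k') r)" if "k \<in> K" for k
    using K that unfolding greedy_choice_def by blast
  then obtain r where r: "\<And>k. k \<in> K \<Longrightarrow> E (c k) (r k)" "\<And>k. k \<in> K \<Longrightarrow> r k \<notin> marked E c k"
    "\<And>k k'. k \<in> K \<Longrightarrow> k' \<in> K \<Longrightarrow> k < k' \<Longrightarrow> \<not> E (c k') (r k)"
    by metis
  have lt: False if "k \<in> K" "k' \<in> K" "k < k'" "E w (r k)" "E w (r k')" for k k' w
  proof -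
    have "k' < n" using that K unfolding greedy_choice_def by auto
    moreover have "r k \<in> marked E c (Suc k')"
      using r(1)[OF that(1)] that(3) less_SucI unfolding marked_def by blast
    ultimately have "E (c k') (r k)" using mcs_order_dominates[OF mcs] r that by blast
    then show False using r(3) that by blast
  qed
  have eq: "k = k'" if "k \<in> K" "k' \<in> K" "E w (r k)" "E w (r k')" for k k' w
    using lt that by (metis linorder_neqE_nat)
  have "inj_on r K" using eq r(1) by (intro inj_onI) metis
  then have "card (r ` K) = card K" by (rule card_image)
  then show ?thesis using r(1) eq by (intro that[of "r ` K"]) blast+
qed

text \<open>If no later kept column dominates \<open>v\<close>, then \<open>v\<close> itself is a
  reason to keep its first cover.\<close>

lemma greedy_cover:
  assumes mcs: "mcs_order V E n c" "c ` {..<n} = V" and K: "greedy_choice E c 0 n K"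
    and v: "E w v"
  shows "\<exists>k \<in> K. E (c k) v"
proof -
  have "\<exists>k<n. E (c k) v" using v adj_in_V mcs(2) by blast
  define k where "k = (LEAST k. E (c k) v)"
  have k: "E (c k) v" "k < n" "v \<notin> marked E c k"
  proof -
    obtain j where j: "j < n" "E (c j) v" using \<open>\<exists>k<n. E (c k) v\<close> by blast
    show "E (c k) v" using j LeastI[of "\<lambda>k. E (c k) v" j] unfolding k_def by auto
    show "k < n" using j Least_le[of "\<lambda>k. E (c k) v" j] unfolding k_def by auto
    show "v \<notin> marked E c k" using not_less_Least unfolding k_def marked_def by blast
  qed
  show ?thesis
  proof (cases "\<exists>k' \<in> K. k < k' \<and> E (c k') v")
    case False
    then have "k \<in> K" using K k unfolding greedy_choice_def by (metis atLeastLessThan_iff le0)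
    then show ?thesis using k(1) by blast
  qed blast
qed

end


section \<open>Parameters of chordal bipartite graphs\<close>

text \<open>\<open>\<mu>\<close> is an infimum of walk costs in the extended reals, and with unit
  weights a cost is a length. Hence only walks with at most two arcs have to be inspected.\<close>

lemma (in wf_digraph) distance_eq_2_iff:
  assumes "u \<in> verts G" "v \<in> verts G"
  shows "\<mu> (\<lambda>_. 1) u v = 2 \<longleftrightarrow> u \<noteq> v \<and> \<not> u \<rightarrow> v \<and> (\<exists>w. u \<rightarrow> w \<and> w \<rightarrow> v)"
proof -
  have cost: "awalk_cost (\<lambda>_. 1) p = real (length p)" for p
    by (induction p) auto
  have le: "\<mu> (\<lambda>_. 1) u v \<le> ereal (real (length p))" if "awalk u p v" for p
    using min_cost_le_walk_cost[OF that, of "\<lambda>_. 1"] cost by simp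
  have w0: "awalk u [] v" if "u = v"
    using that assms by (simp add: awalk_Nil_iff)
  have w1: "\<exists>e. awalk u [e] v" if "u \<rightarrow> v"
    using that assms by (auto simp: awalk_simps elim!: reachableE)
  have w2: "\<exists>e f. awalk u [e, f] v" if "u \<rightarrow> w" "w \<rightarrow> v" for w
    using that assms by (fastforce simp: awalk_simps elim!: reachableE)
  have adj: "a \<rightarrow> b" if "e \<in> arcs G" "tail G e = a" "head G e = b" for e a b
    using that by (auto simp: arcs_ends_conv)
  have short: "u = v \<or> u \<rightarrow> v \<or> (\<exists>w. u \<rightarrow> w \<and> w \<rightarrow> v)" if p: "awalk u p v" "length p \<le> 2" for p
  proof -
    consider "p = []" | e where "p = [e]" | e f where "p = [e, f]"
      using p(2) by (cases p; cases "tl p"; cases "tl (tl p)") auto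
    then show ?thesis
    proof cases
      case (3 e f)
      then have "u \<rightarrow> head G e" "head G e \<rightarrow> v"
        using p(1) adj[of e] adj[of f] by (auto simp: awalk_simps)
      then show ?thesis by blast
    qed (use p(1) adj in \<open>auto simp: awalk_simps\<close>)
  qed
  have short1: "u = v \<or> u \<rightarrow> v" if p: "awalk u p v" "length p < 2" for p
  proof -
    consider "p = []" | e where "p = [e]"
      using p(2) by (cases p; cases "tl p") auto
    then show ?thesis
      by cases (use p(1) adj in \<open>auto simp: awalk_simps\<close>)
  qed
  show ?thesis
  proof
    assume eq: "\<mu> (\<lambda>_. 1) u v = 2"
    have len: "2 \<le> length p" if "awalk u p v" for p
    proof -
      have "ereal 2 \<le> ereal (real (length p))" using le[OF that] eq by simp
      then show ?thesis by simp
    qed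
    \<comment> \<open>An infimum strictly below 3 yields a walk of length below 3, without an
      argument that the infimum is attained.\<close>
    have "\<mu> (\<lambda>_. 1) u v < 3" using eq by simp
    then obtain p where p: "awalk u p v" "ereal (real (length p)) < ereal 3"
      unfolding \<mu>_def INF_less_iff cost by auto
    have "length p \<le> 2" using p(2) by simp
    moreover have "u \<noteq> v" using len[OF w0] by auto
    moreover have "\<not> u \<rightarrow> v"
    proof
      assume "u \<rightarrow> v"
      then obtain e where "awalk u [e] v" using w1 by blast
      from len[OF this] show False by simp
    qed
    ultimately show "u \<noteq> v \<and> \<not> u \<rightarrow> v \<and> (\<exists>w. u \<rightarrow> w \<and> w \<rightarrow> v)" using short p(1) by blast
  next
    assume R: "u \<noteq> v \<and> \<not> u \<rightarrow> v \<and> (\<exists>w. u \<rightarrow> w \<and> w \<rightarrow> v)"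
    then obtain e f where "awalk u [e, f] v" using w2 by blast
    from le[OF this] have "\<mu> (\<lambda>_. 1) u v \<le> ereal 2" by simp
    moreover have "ereal 2 \<le> \<mu> (\<lambda>_. 1) u v"
      unfolding \<mu>_def cost
    proof (rule INF_greatest)
      fix p assume "p \<in> {p. awalk u p v}"
      then have "\<not> length p < 2" using short1 R by blast
      then show "ereal 2 \<le> ereal (real (length p))" by simp
    qed
    ultimately show "\<mu> (\<lambda>_. 1) u v = 2" by (simp add: order_antisym)
  qed
qed

section \<open>Chordal bipartite graphs and the min-max equality\<close>

lemma chordal_bipartite_no_long_hole:
  assumes "chordal_bipartite G"
  shows "\<exists>side. bipartite_no_long_hole (verts G) (\<lambda>u v. u \<rightarrow>\<^bsub>G\<^esub> v) side"
proof -
  interpret graph G using assms unfolding chordal_bipartite_def by blast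
  obtain A B where AB: "A \<union> B = verts G" "A \<inter> B = {}"
      "\<And>u v. u \<rightarrow>\<^bsub>G\<^esub> v \<Longrightarrow> (u \<in> A \<and> v \<in> B) \<or> (u \<in> B \<and> v \<in> A)"
    using assms unfolding chordal_bipartite_def bipartite_def by metis
  have "bipartite_no_long_hole (verts G) (\<lambda>u v. u \<rightarrow>\<^bsub>G\<^esub> v) (\<lambda>v. v \<in> A)"
  proof
    show "finite (verts G)" by simp
    show "v \<rightarrow>\<^bsub>G\<^esub> u" if "u \<rightarrow>\<^bsub>G\<^esub> v" for u v
      by (rule arcs_ends_symmetric[OF sym_arcs that])
    show "u \<in> verts G" if "u \<rightarrow>\<^bsub>G\<^esub> v" for u v using that adj_in_verts by blast
    show "(u \<in> A) = (\<not> v \<in> A)" if "u \<rightarrow>\<^bsub>G\<^esub> v" for u v using AB(2) AB(3)[OF that] by blast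
    show "\<not> (\<forall>i < length cs. \<forall>j < length cs.
        cs ! i \<rightarrow>\<^bsub>G\<^esub> cs ! j \<longleftrightarrow> j = Suc i mod length cs \<or> i = Suc j mod length cs)"
      if "6 \<le> length cs" "distinct cs" "set cs \<subseteq> verts G" for cs
      using assms that unfolding chordal_bipartite_def induced_cycle_def by fastforce
  qed
  then show ?thesis by blast
qed

text \<open>Perfection ranges over all induced subgraphs. Adjacency in \<open>H\<close> is that of
  \<open>G\<close> restricted to \<open>verts H\<close>, so a bipartition restricts to
  \<open>H\<close> and an induced cycle of \<open>H\<close> is induced in \<open>G\<close>.\<close>

lemma chordal_bipartite_induced_subgraph:
  assumes G: "chordal_bipartite G" and H: "induced_subgraph H G"
  shows "chordal_bipartite H"
proof -
  interpret G: graph G using G unfolding chordal_bipartite_def by blast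
  have sub: "subgraph H G" using H by blast
  have th: "tail H = tail G" "head H = head G"
    using sub by (auto simp: compatible_tail compatible_head elim!: subgraphE)
  have dom: "u \<rightarrow>\<^bsub>H\<^esub> v \<longleftrightarrow> u \<in> verts H \<and> v \<in> verts H \<and> u \<rightarrow>\<^bsub>G\<^esub> v" for u v
    using H th unfolding induced_subgraph_def arcs_ends_conv by auto
  interpret H: digraph H using sub by (rule G.digraph_subgraph)
  have "symmetric H"
    using G.sym_arcs dom unfolding symmetric_def sym_def by blast
  then have "graph H" by (rule H.graphI)
  moreover have "bipartite H"
  proof -
    obtain A B where AB: "A \<union> B = verts G" "A \<inter> B = {}"
        "\<forall>u v. u \<rightarrow>\<^bsub>G\<^esub> v \<longrightarrow> (u \<in> A \<and> v \<in> B) \<or> (u \<in> B \<and> v \<in> A)"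
      using G unfolding chordal_bipartite_def bipartite_def by metis
    have "verts H \<subseteq> verts G" using sub by blast
    show ?thesis
      unfolding bipartite_def
    proof (intro exI conjI allI impI)
      show "(A \<inter> verts H) \<union> (B \<inter> verts H) = verts H"
        using AB(1) \<open>verts H \<subseteq> verts G\<close> by blast
      show "(A \<inter> verts H) \<inter> (B \<inter> verts H) = {}" using AB(2) by blast
      fix u v assume "u \<rightarrow>\<^bsub>H\<^esub> v"
      then show "u \<in> A \<inter> verts H \<and> v \<in> B \<inter> verts H \<or> u \<in> B \<inter> verts H \<and> v \<in> A \<inter> verts H"
        using AB(3) dom by blast
    qed
  qed
  moreover have "induced_cycle G cs" if "induced_cycle H cs" for cs
  proof -
    have "set cs \<subseteq> verts H" using that unfolding induced_cycle_def by blast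
    then have "cs ! i \<rightarrow>\<^bsub>H\<^esub> cs ! j \<longleftrightarrow> cs ! i \<rightarrow>\<^bsub>G\<^esub> cs ! j"
      if "i < length cs" "j < length cs" for i j
      using dom that by (meson nth_mem subsetD)
    moreover have "verts H \<subseteq> verts G" using sub by blast
    ultimately show ?thesis using that unfolding induced_cycle_def by auto
  qed
  ultimately show ?thesis using G unfolding chordal_bipartite_def by blast
qed

text \<open>Each optimum appears as a bound together with its attainment, because the numbers and
  the decision versions are both derived from this form. The order and \<open>K\<close> are
  arbitrary, so the result applies to whatever the program happens to compute.\<close>

lemma chordal_bipartite_parameters:
  fixes G :: "('a, 'b) pre_digraph"
  assumes G: "chordal_bipartite G"
    and mcs: "mcs_order (verts G) (\<lambda>u v. u \<rightarrow>\<^bsub>G\<^esub> v) n c" "c ` {..<n} = verts G"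
    and K: "greedy_choice (\<lambda>u v. u \<rightarrow>\<^bsub>G\<^esub> v) c 0 n K"
    and m: "m = card K + card {v \<in> verts G. neighbors G v = {}}"
  shows "(\<exists>S. separated_cluster G S \<and> card S = m) \<and> (\<forall>S. separated_cluster G S \<longrightarrow> card S \<le> m)"
    and "(\<exists>f. cd_coloring G f \<and> card (f ` verts G) = m) \<and>
      (\<forall>f. cd_coloring G f \<longrightarrow> m \<le> card (f ` verts G))"
    and "(no_isolated G \<longrightarrow> (\<exists>D. total_dominating_set G D \<and> card D = m)) \<and>
      (\<forall>D. total_dominating_set G D \<longrightarrow> m \<le> card D)"
proof -
  interpret graph G using G unfolding chordal_bipartite_def by blast
  obtain side where "bipartite_no_long_hole (verts G) (\<lambda>u v. u \<rightarrow>\<^bsub>G\<^esub> v) side"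
    using chordal_bipartite_no_long_hole[OF G] by blast
  then interpret bipartite_no_long_hole "verts G" "\<lambda>u v. u \<rightarrow>\<^bsub>G\<^esub> v" side .
  define I where "I = {v \<in> verts G. neighbors G v = {}}"
  have nbr: "u \<in> neighbors G v \<longleftrightarrow> v \<rightarrow>\<^bsub>G\<^esub> u" for u v
    unfolding neighbors_def using adj_in_verts by blast
  have I: "v \<in> I \<longleftrightarrow> v \<in> verts G \<and> (\<forall>w. \<not> w \<rightarrow>\<^bsub>G\<^esub> v)" for v
    unfolding I_def using nbr sym by blast
  have finI: "finite I" unfolding I_def by simp
  have finK: "finite K" and Kn: "K \<subseteq> {..<n}"
    using K finite_subset unfolding greedy_choice_def by auto
  obtain P where P: "card P = card K" "\<And>r. r \<in> P \<Longrightarrow> \<exists>v. v \<rightarrow>\<^bsub>G\<^esub> r"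
    "\<And>r r' w. r \<in> P \<Longrightarrow> r' \<in> P \<Longrightarrow> w \<rightarrow>\<^bsub>G\<^esub> r \<Longrightarrow> w \<rightarrow>\<^bsub>G\<^esub> r' \<Longrightarrow> r = r'"
    using greedy_packing[OF mcs K] by metis
  have PV: "P \<subseteq> verts G" using P(2) adj_in_verts by blast
  have finP: "finite P" using PV finite_V by (rule finite_subset)
  have "P \<inter> I = {}" using P(2) I by blast
  then have cardPI: "card (P \<union> I) = m"
    using finP finI P(1) m by (simp add: card_Un_disjoint I_def)
  \<comment> \<open>Adjacent vertices of a bipartite graph have no common neighbour, so distance 2
    means being distinct with a common neighbour.\<close>
  have cluster: "separated_cluster G S \<longleftrightarrow>
      S \<subseteq> verts G \<and> (\<forall>u \<in> S. \<forall>v \<in> S. \<forall>w. w \<rightarrow>\<^bsub>G\<^esub> u \<longrightarrow> w \<rightarrow>\<^bsub>G\<^esub> v \<longrightarrow> u = v)" for S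
  proof (cases "S \<subseteq> verts G")
    case True
    have "\<mu> (\<lambda>_. 1) u v \<noteq> 2 \<longleftrightarrow> (\<forall>w. w \<rightarrow>\<^bsub>G\<^esub> u \<longrightarrow> w \<rightarrow>\<^bsub>G\<^esub> v \<longrightarrow> u = v)" if "u \<in> S" "v \<in> S" for u v
    proof -
      have "\<not> u \<rightarrow>\<^bsub>G\<^esub> v" if "w \<rightarrow>\<^bsub>G\<^esub> u" "w \<rightarrow>\<^bsub>G\<^esub> v" for w using that side by blast
      moreover have V: "u \<in> verts G" "v \<in> verts G" using that True by auto
      ultimately show ?thesis using sym unfolding distance_eq_2_iff[OF V] by blast
    qed
    then show ?thesis unfolding separated_cluster_def using True by blast
  qed (simp add: separated_cluster_def)
  have clPI: "separated_cluster G (P \<union> I)"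
    unfolding cluster using PV P(3) I by blast
  then have c1: "\<exists>S. separated_cluster G S \<and> card S = m" using cardPI by blast
  \<comment> \<open>Two vertices of one colour are nonadjacent and lie in one closed neighbourhood,
    so they are equal or share a neighbour. A cluster therefore meets each colour class at most
    once.\<close>
  have cluster_le: "card S \<le> card (f ` verts G)"
    if S: "separated_cluster G S" and f: "cd_coloring G f" for S f
  proof -
    have "inj_on f S"
    proof
      fix u v assume uv: "u \<in> S" "v \<in> S" "f u = f v"
      have V: "u \<in> verts G" "v \<in> verts G" using S uv unfolding cluster by auto
      then obtain w where "{x \<in> verts G. f x = f u} \<subseteq> insert w (neighbors G w)"
        using f unfolding cd_coloring_def by blast
      then have w: "u = w \<or> w \<rightarrow>\<^bsub>G\<^esub> u" "v = w \<or> w \<rightarrow>\<^bsub>G\<^esub> v" using V uv nbr by auto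
      have "\<not> u \<rightarrow>\<^bsub>G\<^esub> v" "\<not> v \<rightarrow>\<^bsub>G\<^esub> u" using f V uv(3) unfolding cd_coloring_def by metis+
      then show "u = v" using w S uv unfolding cluster by blast
    qed
    then have "card S = card (f ` S)" by (simp add: card_image)
    also have "\<dots> \<le> card (f ` verts G)"
      using S unfolding cluster by (intro card_mono image_mono) auto
    finally show ?thesis .
  qed
  have col_ge: "m \<le> card (f ` verts G)" if "cd_coloring G f" for f
    using cluster_le[OF clPI that] cardPI by simp
  obtain h :: "'a \<Rightarrow> nat" where h: "inj_on h (verts G)"
    using finite_imp_inj_to_nat_seg[OF finite_verts] by blast
  define g where "g v = (SOME k. k \<in> K \<and> c k \<rightarrow>\<^bsub>G\<^esub> v)" for v
  have g: "g v \<in> K" "c (g v) \<rightarrow>\<^bsub>G\<^esub> v" if "w \<rightarrow>\<^bsub>G\<^esub> v" for v w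
  proof -
    have "\<exists>k. k \<in> K \<and> c k \<rightarrow>\<^bsub>G\<^esub> v" using greedy_cover[OF mcs K that] by blast
    from someI_ex[OF this] show "g v \<in> K" "c (g v) \<rightarrow>\<^bsub>G\<^esub> v" unfolding g_def by auto
  qed
  \<comment> \<open>A non-isolated vertex is coloured by a kept column adjacent to it, so its class
    lies in one neighbourhood and hence on one side. Isolated vertices get private colours from
    \<open>n\<close> on, which cannot clash with column indices below \<open>n\<close>.\<close>
  define f where "f v = (if v \<in> I then n + h v else g v)" for v
  have fg: "f v = g v" "g v \<in> K" "g v < n" "c (g v) \<rightarrow>\<^bsub>G\<^esub> v" if v: "v \<in> verts G" "v \<notin> I" for v
  proof -
    obtain w where w: "w \<rightarrow>\<^bsub>G\<^esub> v" using v I by blast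
    show "f v = g v" using v(2) unfolding f_def by simp
    show "g v \<in> K" "c (g v) \<rightarrow>\<^bsub>G\<^esub> v" using g[OF w] .
    then show "g v < n" using Kn by blast
  qed
  have cdf: "cd_coloring G f"
    unfolding cd_coloring_def
  proof (intro conjI ballI impI)
    fix u v assume uv: "u \<in> verts G" "v \<in> verts G" "u \<rightarrow>\<^bsub>G\<^esub> v"
    then have "u \<notin> I" "v \<notin> I" using I sym by blast+
    then show "f u \<noteq> f v" using fg[of u] fg[of v] uv side by metis
  next
    fix k assume "k \<in> f ` verts G"
    then obtain v where v: "v \<in> verts G" "k = f v" by blast
    show "\<exists>v \<in> verts G. {u \<in> verts G. f u = k} \<subseteq> insert v (neighbors G v)"
    proof (cases "v \<in> I")
      case True
      have "u = v" if u: "u \<in> verts G" "f u = k" for u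
      proof (cases "u \<in> I")
        case uI: True
        then have "h u = h v" using u v True unfolding f_def by auto
        then show ?thesis using h u v by (auto dest: inj_onD)
      next
        case False
        then have "f u < n" using fg[of u] u by simp
        then show ?thesis using u(2) v(2) True unfolding f_def by auto
      qed
      then show ?thesis using v(1) by blast
    next
      case False
      have "c k \<rightarrow>\<^bsub>G\<^esub> u" if u: "u \<in> verts G" "f u = k" for u
      proof -
        have "k < n" using fg[of v] v False by simp
        then have "u \<notin> I" using u unfolding f_def by auto
        then show ?thesis using fg[of u] u by auto
      qed
      moreover have "c k \<in> verts G" using fg[of v] v False adj_in_verts by auto
      ultimately show ?thesis using nbr by blast
    qed
  qed
  have "f ` verts G \<subseteq> K \<union> (\<lambda>v. n + h v) ` I"
    using fg unfolding f_def by auto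
  then have "card (f ` verts G) \<le> card (K \<union> (\<lambda>v. n + h v) ` I)"
    using finK finI by (intro card_mono) auto
  also have "\<dots> \<le> card K + card I"
    using card_Un_le[of K "(\<lambda>v. n + h v) ` I"] card_image_le[OF finI, of "\<lambda>v. n + h v"] by linarith
  finally have cf: "card (f ` verts G) \<le> m" using m unfolding I_def by simp
  then have c3: "\<exists>f. cd_coloring G f \<and> card (f ` verts G) = m"
    using cdf col_ge le_antisym by blast
  have c2: "card S \<le> m" if "separated_cluster G S" for S
    using cluster_le[OF that cdf] cf by simp
  \<comment> \<open>Each packed row picks a neighbour in \<open>D\<close>, and the picks are
    distinct. The existence of \<open>D\<close> also excludes isolated vertices, so the packing
    already has size \<open>m\<close>.\<close>
  have tds_ge: "m \<le> card D" if D: "total_dominating_set G D" for D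
  proof -
    have D': "D \<subseteq> verts G" "\<And>v. v \<in> verts G \<Longrightarrow> \<exists>d. d \<in> D \<and> d \<rightarrow>\<^bsub>G\<^esub> v"
      using D nbr sym unfolding total_dominating_set_def by blast+
    then have "I = {}" using I by blast
    define d where "d v = (SOME d. d \<in> D \<and> d \<rightarrow>\<^bsub>G\<^esub> v)" for v
    have d: "d v \<in> D" "d v \<rightarrow>\<^bsub>G\<^esub> v" if "v \<in> verts G" for v
      using someI_ex[OF D'(2)[OF that]] unfolding d_def by auto
    have "inj_on d P"
    proof
      fix u v assume "u \<in> P" "v \<in> P" "d u = d v"
      then show "u = v" using P(3) d PV by (metis subsetD)
    qed
    then have "card P = card (d ` P)" by (simp add: card_image)
    also have "\<dots> \<le> card D"
      using d PV D'(1) finite_subset[OF D'(1)] by (intro card_mono) auto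
    finally show ?thesis using m P(1) \<open>I = {}\<close> unfolding I_def by simp
  qed
  have c5: "\<exists>D. total_dominating_set G D \<and> card D = m" if "no_isolated G"
  proof -
    have "I = {}" using that unfolding no_isolated_def I_def by blast
    have "total_dominating_set G (c ` K)"
      unfolding total_dominating_set_def
    proof (intro conjI ballI)
      show "c ` K \<subseteq> verts G" using Kn mcs(2) by blast
      fix v assume v: "v \<in> verts G"
      then obtain w where "w \<rightarrow>\<^bsub>G\<^esub> v" using \<open>I = {}\<close> I by blast
      then obtain k where "k \<in> K" "c k \<rightarrow>\<^bsub>G\<^esub> v" using greedy_cover[OF mcs K] by blast
      moreover from this have "c k \<in> neighbors G v" using nbr sym by simp
      ultimately show "neighbors G v \<inter> c ` K \<noteq> {}" by blast
    qed
    moreover have "card (c ` K) \<le> m" using card_image_le[OF finK, of c] m by simp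
    ultimately show ?thesis using tds_ge le_antisym by blast
  qed
  show "(\<exists>S. separated_cluster G S \<and> card S = m) \<and> (\<forall>S. separated_cluster G S \<longrightarrow> card S \<le> m)"
    using c1 c2 by blast
  show "(\<exists>f. cd_coloring G f \<and> card (f ` verts G) = m) \<and>
      (\<forall>f. cd_coloring G f \<longrightarrow> m \<le> card (f ` verts G))"
    using c3 col_ge by blast
  show "(no_isolated G \<longrightarrow> (\<exists>D. total_dominating_set G D \<and> card D = m)) \<and>
      (\<forall>D. total_dominating_set G D \<longrightarrow> m \<le> card D)"
    using c5 tds_ge by blast
qed

lemma chordal_bipartite_numbers:
  assumes G: "chordal_bipartite G"
    and mcs: "mcs_order (verts G) (\<lambda>u v. u \<rightarrow>\<^bsub>G\<^esub> v) n c" "c ` {..<n} = verts G"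
    and K: "greedy_choice (\<lambda>u v. u \<rightarrow>\<^bsub>G\<^esub> v) c 0 n K"
    and m: "m = card K + card {v \<in> verts G. neighbors G v = {}}"
  shows "separated_cluster_number G = m" "cd_chromatic_number G = m"
    and "no_isolated G \<Longrightarrow> total_domination_number G = m"
proof -
  note p = chordal_bipartite_parameters[OF assms]
  interpret graph G using G unfolding chordal_bipartite_def by blast
  have "{card S |S. separated_cluster G S} \<subseteq> card ` Pow (verts G)"
    unfolding separated_cluster_def by blast
  then have "finite {card S |S. separated_cluster G S}" by (rule finite_subset) simp
  then show "separated_cluster_number G = m"
    unfolding separated_cluster_number_def using p(1) by (intro Max_eqI) auto
  show "cd_chromatic_number G = m"
    unfolding cd_chromatic_number_def using p(2) by (intro Least_equality) auto
  show "total_domination_number G = m" if "no_isolated G"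
    unfolding total_domination_number_def using p(3) that by (intro Least_equality) auto
qed

section \<open>Perfection and the decision versions\<close>

lemma mcs_order_surj:
  assumes "mcs_order V E (card V) c" "finite V"
  shows "c ` {..<card V} = V"
proof (rule card_subset_eq)
  have "inj_on c {..<card V}" using assms(1) unfolding mcs_order_def by blast
  then show "card (c ` {..<card V}) = card V" by (simp add: card_image)
  show "c ` {..<card V} \<subseteq> V" using assms(1) unfolding mcs_order_def by blast
qed (fact assms(2))

lemma chordal_bipartite_mcs_exists:
  fixes G :: "('a, 'b) pre_digraph"
  assumes "chordal_bipartite G"
  obtains c K where "mcs_order (verts G) (\<lambda>u v. u \<rightarrow>\<^bsub>G\<^esub> v) (card (verts G)) c"
    "c ` {..<card (verts G)} = verts G"
    "greedy_choice (\<lambda>u v. u \<rightarrow>\<^bsub>G\<^esub> v) c 0 (card (verts G)) K"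
proof -
  interpret graph G using assms unfolding chordal_bipartite_def by blast
  obtain c where c: "mcs_order (verts G) (\<lambda>u v. u \<rightarrow>\<^bsub>G\<^esub> v) (card (verts G)) c"
    using mcs_order_exists[of "verts G"] by auto
  obtain K where "greedy_choice (\<lambda>u v. u \<rightarrow>\<^bsub>G\<^esub> v) c 0 (card (verts G)) K"
    using greedy_choice_exists by blast
  then show ?thesis using that c mcs_order_surj[OF c] by simp
qed

lemma chordal_bipartite_cd_perfect:
  "chordal_bipartite G \<Longrightarrow> cd_perfect G"
  unfolding cd_perfect_def
proof (intro allI impI)
  fix H assume "chordal_bipartite G" "induced_subgraph H G"
  then have H: "chordal_bipartite H" by (rule chordal_bipartite_induced_subgraph)
  from chordal_bipartite_mcs_exists[OF H] obtain c K where
    "mcs_order (verts H) (dominates H) (card (verts H)) c" "c ` {..<card (verts H)} = verts H"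
    "greedy_choice (dominates H) c 0 (card (verts H)) K" .
  from chordal_bipartite_numbers(1,2)[OF H this refl]
  show "cd_chromatic_number H = separated_cluster_number H" by simp
qed

lemma attained_bound_le_iff:
  fixes m :: nat
  assumes "\<exists>x. P x \<and> f x = m" "\<And>x. P x \<Longrightarrow> m \<le> f x"
  shows "(\<exists>x. P x \<and> f x \<le> k) \<longleftrightarrow> m \<le> k"
proof
  assume "\<exists>x. P x \<and> f x \<le> k"
  then obtain x where "P x" "f x \<le> k" by blast
  with assms(2)[of x] show "m \<le> k" by simp
qed (use assms(1) in auto)

lemma attained_bound_ge_iff:
  fixes m :: nat
  assumes "\<exists>x. P x \<and> f x = m" "\<And>x. P x \<Longrightarrow> f x \<le> m"
  shows "(\<exists>x. P x \<and> k \<le> f x) \<longleftrightarrow> k \<le> m"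
proof
  assume "\<exists>x. P x \<and> k \<le> f x"
  then obtain x where "P x" "k \<le> f x" by blast
  with assms(2)[of x] show "k \<le> m" by simp
qed (use assms(1) in auto)

text \<open>The cluster problem is a maximisation: its optimum is at most \<open>k\<close> exactly
  if no cluster has size \<open>k + 1\<close> or more, hence the negation.\<close>

lemma chordal_bipartite_duality:
  assumes "chordal_bipartite G" "no_isolated G"
  shows "total_domination_number G = cd_chromatic_number G"
    and "cd_chromatic_number G = separated_cluster_number G"
    and "(\<exists>S. total_dominating_set G S \<and> card S \<le> k) \<longleftrightarrow>
                 (\<exists>f. cd_coloring G f \<and> card (f ` verts G) \<le> k)"
    and "(\<exists>f. cd_coloring G f \<and> card (f ` verts G) \<le> k) \<longleftrightarrow>
                 \<not> (\<exists>S. separated_cluster G S \<and> card S \<ge> k + 1)"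
proof -
  obtain c K where cK: "mcs_order (verts G) (\<lambda>u v. u \<rightarrow>\<^bsub>G\<^esub> v) (card (verts G)) c"
    "c ` {..<card (verts G)} = verts G"
    "greedy_choice (\<lambda>u v. u \<rightarrow>\<^bsub>G\<^esub> v) c 0 (card (verts G)) K"
    using chordal_bipartite_mcs_exists[OF assms(1)] .
  note p = chordal_bipartite_parameters[OF assms(1) cK refl]
    and q = chordal_bipartite_numbers[OF assms(1) cK refl]
  show "total_domination_number G = cd_chromatic_number G"
    "cd_chromatic_number G = separated_cluster_number G"
    using q assms(2) by auto
  let ?m = "card K + card {v \<in> verts G. neighbors G v = {}}"
  have "(\<exists>S. total_dominating_set G S \<and> card S \<le> k) \<longleftrightarrow> ?m \<le> k"
    by (rule attained_bound_le_iff) (use p(3) assms(2) in blast)+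
  moreover have col: "(\<exists>f. cd_coloring G f \<and> card (f ` verts G) \<le> k) \<longleftrightarrow> ?m \<le> k"
    by (rule attained_bound_le_iff) (use p(2) in blast)+
  ultimately show "(\<exists>S. total_dominating_set G S \<and> card S \<le> k) \<longleftrightarrow>
      (\<exists>f. cd_coloring G f \<and> card (f ` verts G) \<le> k)" by simp
  have "(\<exists>S. separated_cluster G S \<and> card S \<ge> k + 1) \<longleftrightarrow> k + 1 \<le> ?m"
    by (rule attained_bound_ge_iff) (use p(1) in blast)+
  then show "(\<exists>f. cd_coloring G f \<and> card (f ` verts G) \<le> k) \<longleftrightarrow>
      \<not> (\<exists>S. separated_cluster G S \<and> card S \<ge> k + 1)" using col by auto
qed


section \<open>A program with quadratic running time\<close>

text \<open>Total correctness with a clock: \<open>t\<close> is the time already spent and the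
  postcondition sees the running total. The existence of a derivation includes termination and the
  observance of the word bound.\<close>

definition wp :: "nat \<Rightarrow> com \<Rightarrow> (nat \<Rightarrow> state \<Rightarrow> bool) \<Rightarrow> nat \<Rightarrow> state \<Rightarrow> bool" where
  "wp W p Q t s \<longleftrightarrow> (\<exists>t' s'. exec W p s t' s' \<and> Q (t + t') s')"

lemma wp_Skip: "Q (t + 1) s \<Longrightarrow> wp W Skip Q t s"
  unfolding wp_def using exec.Skip by blast

lemma wp_Assign:
  "\<lbrakk>fits W i s; fits W a s; Q (t + (1 + cost i + cost a)) (s(x := (s x)(val i s := val a s)))\<rbrakk> \<Longrightarrow>
    wp W (Assign x i a) Q t s"
  unfolding wp_def using exec.Assign by blast

lemma wp_Seq: "wp W p (wp W q Q) t s \<Longrightarrow> wp W (Seq p q) Q t s"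
  unfolding wp_def using exec.Seq by (metis add.assoc)

lemma wp_If:
  assumes "fits W b s"
    and "val b s \<noteq> 0 \<Longrightarrow> wp W p Q (t + (1 + cost b)) s"
    and "val b s = 0 \<Longrightarrow> wp W q Q (t + (1 + cost b)) s"
  shows "wp W (If b p q) Q t s"
proof (cases "val b s = 0")
  case True
  with assms(3) obtain t' s' where "exec W q s t' s'" "Q (t + (1 + cost b) + t') s'"
    unfolding wp_def by blast
  then show ?thesis
    using exec.IfFalse[OF assms(1) True] unfolding wp_def by (metis add.assoc)
next
  case False
  with assms(2) obtain t' s' where "exec W p s t' s'" "Q (t + (1 + cost b) + t') s'"
    unfolding wp_def by blast
  then show ?thesis
    using exec.IfTrue[OF assms(1) False] unfolding wp_def by (metis add.assoc)
qed

lemma wp_mono: "wp W p Q t s \<Longrightarrow> (\<And>t s. Q t s \<Longrightarrow> Q' t s) \<Longrightarrow> wp W p Q' t s"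
  unfolding wp_def by blast

lemma wp_While_unfold:
  assumes "fits W b s" "val b s \<noteq> 0"
    and "wp W p (wp W (While b p) Q) (t + (1 + cost b)) s"
  shows "wp W (While b p) Q t s"
proof -
  obtain t1 s1 t2 s2 where "exec W p s t1 s1" "exec W (While b p) s1 t2 s2"
      "Q (t + (1 + cost b) + t1 + t2) s2"
    using assms(3) unfolding wp_def by blast
  then show ?thesis
    using exec.WhileTrue[OF assms(1,2)] unfolding wp_def by (metis add.assoc)
qed

lemma wp_While_exit:
  assumes "fits W b s" "val b s = 0" "Q (t + (1 + cost b)) s"
  shows "wp W (While b p) Q t s"
  using exec.WhileFalse[OF assms(1,2)] assms(3) unfolding wp_def by blast

abbreviation Var :: "string \<Rightarrow> exp" where
  "Var x \<equiv> Cell x (Const 0)"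

text \<open>Subtraction is truncated, so the test is nonzero exactly while the counter is below
  \<open>n\<close>. Initialisation costs 3 steps, a test 6 and an increment 6; these are the
  constants of the loop rule.\<close>

definition For :: "string \<Rightarrow> com \<Rightarrow> com" where
  "For x p = Seq (Assign x (Const 0) (Const 0))
     (While (Minus (Var ''n'') (Var x)) (Seq p (Assign x (Const 0) (Plus (Var x) (Const 1)))))"

text \<open>\<open>t\<close> is the total running time so far, so that an invariant may bound it by a potential.\<close>

lemma wp_For:
  assumes W: "N + 1 < W" and x: "x \<noteq> ''n''" and n: "s ''n'' 0 = N"
    and init: "I 0 (t + 3) (s(x := (s x)(0 := 0)))"
    and body: "\<And>k t s. \<lbrakk>k < N; s x 0 = k; s ''n'' 0 = N; I k t s\<rbrakk> \<Longrightarrow>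
      wp W p (\<lambda>t s. s x 0 = k \<and> s ''n'' 0 = N \<and> I (Suc k) (t + 6) (s(x := (s x)(0 := Suc k)))) (t + 6) s"
    and exit: "\<And>t s. \<lbrakk>s x 0 = N; s ''n'' 0 = N; I N t s\<rbrakk> \<Longrightarrow> Q (t + 6) s"
  shows "wp W (For x p) Q t s"
proof -
  let ?b = "Minus (Var ''n'') (Var x)"
  let ?p = "Seq p (Assign x (Const 0) (Plus (Var x) (Const 1)))"
  have loop: "wp W (While ?b ?p) Q t s"
    if "k \<le> N" "s x 0 = k" "s ''n'' 0 = N" "I k t s" for k t s
    using that
  proof (induction k arbitrary: t s rule: inc_induct)
    case base
    have "Q (t + (1 + cost (Minus (Var ''n'') (Var x)))) s"
      using exit[OF base(1,2,3)] by (simp add: eval_nat_numeral)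
    then show ?case using base W by (intro wp_While_exit) auto
  next
    case (step k)
    show ?case
    proof (rule wp_While_unfold)
      show "fits W ?b s" "val ?b s \<noteq> 0" using step W by auto
      have "wp W p (wp W (Assign x (Const 0) (Plus (Var x) (Const 1))) (wp W (While ?b ?p) Q)) (t + 6) s"
        using body[OF step.hyps(2) step.prems]
      proof (rule wp_mono)
        fix t' s' assume *: "s' x 0 = k \<and> s' ''n'' 0 = N \<and> I (Suc k) (t' + 6) (s'(x := (s' x)(0 := Suc k)))"
        show "wp W (Assign x (Const 0) (Plus (Var x) (Const 1))) (wp W (While ?b ?p) Q) t' s'"
        proof (rule wp_Assign)
          have "wp W (While ?b ?p) Q (t' + 6) (s'(x := (s' x)(0 := Suc k)))"
          proof (rule step.IH)
            show "I (Suc k) (t' + 6) (s'(x := (s' x)(0 := Suc k)))" using * by blast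
          qed (use * x in auto)
          moreover have "1 + cost (Const 0) + cost (Plus (Var x) (Const 1)) = 6" by simp
          moreover have "s'(x := (s' x)(val (Const 0) s' := val (Plus (Var x) (Const 1)) s'))
              = s'(x := (s' x)(0 := Suc k))" using * by simp
          ultimately show "wp W (While ?b ?p) Q
             (t' + (1 + cost (Const 0) + cost (Plus (Var x) (Const 1))))
             (s'(x := (s' x)(val (Const 0) s' := val (Plus (Var x) (Const 1)) s')))"
            by (simp only:)
        qed (use * W step.hyps(2) in auto)
      qed
      then show "wp W ?p (wp W (While ?b ?p) Q) (t + (1 + cost ?b)) s"
        by (intro wp_Seq) (simp add: eval_nat_numeral)
    qed
  qed
  show ?thesis
    unfolding For_def
    by (intro wp_Seq wp_Assign loop[of 0]) (use W x n init in \<open>auto simp: numeral_3_eq_3\<close>)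
qed

lemmas wp_intros = wp_Skip wp_Assign wp_Seq wp_If

text \<open>A frame condition: \<open>X\<close> lists the arrays that a piece of program may change,
  scalars included.\<close>

definition agree :: "string set \<Rightarrow> state \<Rightarrow> state \<Rightarrow> bool" where
  "agree X s s' \<longleftrightarrow> (\<forall>x. x \<notin> X \<longrightarrow> s' x = s x)"

lemma agree_refl [simp]: "agree X s s"
  by (simp add: agree_def)

lemma agree_upd [simp]: "x \<in> X \<Longrightarrow> agree X s (s'(x := a)) \<longleftrightarrow> agree X s s'"
  by (auto simp: agree_def)

section \<open>Data layout and text of the program\<close>

definition adjacency :: "nat \<Rightarrow> (nat \<Rightarrow> nat \<Rightarrow> bool) \<Rightarrow> state \<Rightarrow> bool" where
  "adjacency N E s \<longleftrightarrow> s ''n'' 0 = N \<and> (\<forall>i<N. \<forall>j<N. s ''adj'' (i * N + j) = (if E i j then 1 else 0))"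

abbreviation Adj :: "string \<Rightarrow> string \<Rightarrow> exp" where
  "Adj x y \<equiv> Cell ''adj'' (Plus (Times (Var x) (Var ''n'')) (Var y))"

text \<open>Runs when row \<open>r\<close> becomes covered: each column adjacent to \<open>r\<close>
  gains one covered neighbour. Counters kept up to date in this way spare a recount at every
  selection.\<close>

definition count_row :: com where
  "count_row = For ''j'' (Assign ''cnt'' (Var ''j'') (Plus (Cell ''cnt'' (Var ''j'')) (Adj ''r'' ''j'')))"

text \<open>With truncated subtraction \<open>1 - mark\<close> acts as a negation, and the product
  as a conjunction.\<close>

definition mark_column :: com where
  "mark_column = For ''r''
     (If (Times (Adj ''c'' ''r'') (Minus (Const 1) (Cell ''mark'' (Var ''r''))))
       (Seq (Assign ''mark'' (Var ''r'') (Plus (Var ''k'') (Const 1))) count_row)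
       Skip)"

definition select_column :: com where
  "select_column = For ''j''
     (If (Cell ''used'' (Var ''j'')) Skip
       (If (Minus (Plus (Cell ''cnt'' (Var ''j'')) (Const 1)) (Var ''b''))
         (Seq (Assign ''b'' (Const 0) (Plus (Cell ''cnt'' (Var ''j'')) (Const 1)))
           (Assign ''c'' (Const 0) (Var ''j'')))
         Skip))"

definition search :: com where
  "search = For ''k''
     (Seq (Assign ''b'' (Const 0) (Const 0))
     (Seq select_column
     (Seq (Assign ''used'' (Var ''c'') (Const 1))
     (Seq (Assign ''ord'' (Var ''k'') (Var ''c''))
       mark_column))))"

text \<open>The last two factors encode the equality of \<open>mark r\<close> and
  \<open>n - k\<close>: both truncated differences must vanish. The value \<open>n - k\<close> is
  the mark left by the column with index \<open>n - 1 - k\<close>.\<close>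

definition test_column :: com where
  "test_column = For ''r''
     (If (Times (Minus (Const 1) (Cell ''dom'' (Var ''r'')))
           (Times (Minus (Const 1) (Minus (Cell ''mark'' (Var ''r'')) (Minus (Var ''n'') (Var ''k''))))
             (Minus (Const 1) (Minus (Minus (Var ''n'') (Var ''k'')) (Cell ''mark'' (Var ''r''))))))
       (Assign ''b'' (Const 0) (Const 1))
       Skip)"

definition dominate_column :: com where
  "dominate_column = For ''r''
     (If (Adj ''c'' ''r'') (Assign ''dom'' (Var ''r'') (Const 1)) Skip)"

definition choose_columns :: com where
  "choose_columns = For ''k''
     (Seq (Assign ''c'' (Const 0) (Cell ''ord'' (Minus (Minus (Var ''n'') (Const 1)) (Var ''k''))))
     (Seq (Assign ''b'' (Const 0) (Const 0))
     (Seq test_column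
       (If (Var ''b'')
         (Seq (Assign ''out'' (Const 0) (Plus (Var ''out'') (Const 1))) dominate_column)
         Skip))))"

definition add_isolated :: com where
  "add_isolated = For ''r''
     (If (Cell ''mark'' (Var ''r'')) Skip
       (Assign ''out'' (Const 0) (Plus (Var ''out'') (Const 1))))"

section \<open>Correctness and running time of the inner loops\<close>

lemma index_less: "i < N \<Longrightarrow> j < N \<Longrightarrow> i * N + j < N * (N :: nat)"
proof -
  assume "i < N" "j < N"
  then have "i * N + j < Suc i * N" by simp
  also have "\<dots> \<le> N * N" using \<open>i < N\<close> by (intro mult_le_mono1) simp
  finally show ?thesis .
qed

lemma card_Collect_Suc:
  "card {i::nat. i < Suc k \<and> P i} = card {i. i < k \<and> P i} + (if P k then 1 else 0)"
proof -
  have "{i. i < Suc k \<and> P i} = (if P k then insert k {i. i < k \<and> P i} else {i. i < k \<and> P i})"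
    by (auto simp: less_Suc_eq)
  then show ?thesis by simp
qed

context
  fixes N W :: nat and E :: "nat \<Rightarrow> nat \<Rightarrow> bool"
  assumes W: "N * N + 2 * N + 4 < W"
begin

text \<open>Matrix addresses stay below \<open>N * N\<close>. The summand \<open>2 * N\<close> of
  the word bound is room for the output, estimated as at most \<open>N\<close> kept columns plus at
  most \<open>N\<close> isolated vertices.\<close>

lemma W_bounds: "1 < W" "2 < W" "N + 2 < W" "0 < W" "i < N \<Longrightarrow> j < N \<Longrightarrow> i * N + j < W"
  "i < N \<Longrightarrow> i * N < W" "i < N \<Longrightarrow> i < W" "i \<le> N \<Longrightarrow> Suc i < W"
proof -
  show "i < N \<Longrightarrow> j < N \<Longrightarrow> i * N + j < W" using index_less[of i N j] W by linarith
  show "i < N \<Longrightarrow> i * N < W" using index_less[of i N 0] W by linarith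
qed (use W in auto)

text \<open>One iteration takes 28 steps, 12 of them for the loop control; 40 is rounded up, as are
  the factors in the other loops. The bound on the counters keeps the increments within a
  word.\<close>

lemma wp_count_row:
  assumes s: "adjacency N E s" "s ''r'' 0 = r" "r < N"
    and cnt: "\<And>j. j < N \<Longrightarrow> s ''cnt'' j \<le> N"
    and Q: "\<And>t' s'. \<lbrakk>t' \<le> t + 40 * N + 10; agree {''j'', ''cnt''} s s';
       \<And>j. j < N \<Longrightarrow> s' ''cnt'' j = s ''cnt'' j + (if E r j then 1 else 0)\<rbrakk> \<Longrightarrow> Q t' s'"
  shows "wp W count_row Q t s"
  unfolding count_row_def
proof (rule wp_For[where N = N and I = "\<lambda>k t' s'. t' \<le> t + 40 * k + 3 \<and> agree {''j'', ''cnt''} s s' \<and>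
    (\<forall>j<N. s' ''cnt'' j = s ''cnt'' j + (if j < k \<and> E r j then 1 else 0))"])
  fix k t' s'
  assume k: "k < N" "s' ''j'' 0 = k" "s' ''n'' 0 = N"
    and I: "t' \<le> t + 40 * k + 3 \<and> agree {''j'', ''cnt''} s s' \<and>
      (\<forall>j<N. s' ''cnt'' j = s ''cnt'' j + (if j < k \<and> E r j then 1 else 0))"
  have r: "s' ''r'' 0 = r" and adj: "s' ''adj'' (r * N + k) = (if E r k then 1 else 0)"
    using I s k(1) by (auto simp: agree_def adjacency_def)
  have c: "s' ''cnt'' k = s ''cnt'' k" "s ''cnt'' k \<le> N" using I k(1) cnt by auto
  show "wp W (Assign ''cnt'' (Var ''j'') (Plus (Cell ''cnt'' (Var ''j'')) (Adj ''r'' ''j'')))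
     (\<lambda>t' s'. s' ''j'' 0 = k \<and> s' ''n'' 0 = N \<and> t' + 6 \<le> t + 40 * Suc k + 3 \<and>
       agree {''j'', ''cnt''} s (s'(''j'' := (s' ''j'')(0 := Suc k))) \<and>
       (\<forall>j<N. (s'(''j'' := (s' ''j'')(0 := Suc k))) ''cnt'' j
          = s ''cnt'' j + (if j < Suc k \<and> E r j then 1 else 0))) (t' + 6) s'"
    using k I r adj c s(3) W_bounds by (intro wp_intros) (auto simp: less_Suc_eq)
qed (use W_bounds s Q in \<open>auto simp: adjacency_def\<close>)

text \<open>The time is split into a part for every call and a part for newly covered rows, so that
  the caller can charge the latter to rows that are new only once. The assumption on
  \<open>cnt\<close> bounds the final counters and thereby all intermediate ones.\<close>

lemma wp_mark_column:
  assumes s: "adjacency N E s" "s ''c'' 0 = c" "c < N" "s ''k'' 0 = k" "k < N"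
    and mark: "\<And>r. r < N \<Longrightarrow> s ''mark'' r < W"
    and cnt: "\<And>j. j < N \<Longrightarrow> s ''cnt'' j + card {r. r < N \<and> E c r \<and> s ''mark'' r = 0 \<and> E r j} \<le> N"
    and Q: "\<And>t' s'. \<lbrakk>t' \<le> t + 60 * N + 10 + card {r. r < N \<and> E c r \<and> s ''mark'' r = 0} * (40 * N + 40);
       agree {''r'', ''j'', ''cnt'', ''mark''} s s';
       \<And>j. j < N \<Longrightarrow> s' ''cnt'' j = s ''cnt'' j + card {r. r < N \<and> E c r \<and> s ''mark'' r = 0 \<and> E r j};
       \<And>r. r < N \<Longrightarrow> s' ''mark'' r = (if E c r \<and> s ''mark'' r = 0 then k + 1 else s ''mark'' r)\<rbrakk> \<Longrightarrow> Q t' s'"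
  shows "wp W mark_column Q t s"
proof -
  let ?new = "\<lambda>i. {r. r < i \<and> E c r \<and> s ''mark'' r = 0}"
  let ?I = "\<lambda>i t' s'. t' \<le> t + 60 * i + 3 + card (?new i) * (40 * N + 40) \<and>
    agree {''r'', ''j'', ''cnt'', ''mark''} s s' \<and>
    (\<forall>j<N. s' ''cnt'' j = s ''cnt'' j + card {r. r < i \<and> E c r \<and> s ''mark'' r = 0 \<and> E r j}) \<and>
    (\<forall>r<N. s' ''mark'' r = (if r < i \<and> E c r \<and> s ''mark'' r = 0 then k + 1 else s ''mark'' r))"
  show ?thesis
    unfolding mark_column_def
  proof (rule wp_For[where N = N and I = ?I])
    fix i t' s'
    assume i: "i < N" "s' ''r'' 0 = i" "s' ''n'' 0 = N" and I: "?I i t' s'"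
    have ag: "agree {''r'', ''j'', ''cnt'', ''mark''} s s'" using I by blast
    have adj: "adjacency N E s'" and ck: "s' ''c'' 0 = c" "s' ''k'' 0 = k"
      using ag s by (auto simp: agree_def adjacency_def)
    have adjc: "s' ''adj'' (c * N + i) = (if E c i then 1 else 0)"
      using adj s(3) i(1) unfolding adjacency_def by blast
    have mi: "s' ''mark'' i = s ''mark'' i" "s ''mark'' i < W" using I i(1) mark by auto
    have cS: "card {r. r < Suc i \<and> E c r \<and> s ''mark'' r = 0 \<and> E r j} =
        card {r. r < i \<and> E c r \<and> s ''mark'' r = 0 \<and> E r j} +
        (if E c i \<and> s ''mark'' i = 0 \<and> E i j then 1 else 0)" for j
      by (rule card_Collect_Suc)
    have nS: "card (?new (Suc i)) = card (?new i) + (if E c i \<and> s ''mark'' i = 0 then 1 else 0)"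
      by (rule card_Collect_Suc)
    let ?Q = "\<lambda>t s. s ''r'' 0 = i \<and> s ''n'' 0 = N \<and> ?I (Suc i) (t + 6) (s(''r'' := (s ''r'')(0 := Suc i)))"
    show "wp W (If (Times (Adj ''c'' ''r'') (Minus (Const 1) (Cell ''mark'' (Var ''r''))))
       (Seq (Assign ''mark'' (Var ''r'') (Plus (Var ''k'') (Const 1))) count_row) Skip) ?Q (t' + 6) s'"
    proof (rule wp_If)
      show "fits W (Times (Adj ''c'' ''r'') (Minus (Const 1) (Cell ''mark'' (Var ''r'')))) s'"
        using W_bounds i s ck mi adjc by auto
    next
      assume "val (Times (Adj ''c'' ''r'') (Minus (Const 1) (Cell ''mark'' (Var ''r'')))) s' \<noteq> 0"
      then have new: "E c i" "s ''mark'' i = 0" using i ck adjc mi by (auto split: if_splits)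
      have cnt': "s' ''cnt'' j \<le> N" if j: "j < N" for j
      proof -
        have "card {r. r < i \<and> E c r \<and> s ''mark'' r = 0 \<and> E r j}
            \<le> card {r. r < N \<and> E c r \<and> s ''mark'' r = 0 \<and> E r j}"
          using i(1) by (intro card_mono) auto
        then show ?thesis using cnt[OF j] I j by auto
      qed
      show "wp W (Seq (Assign ''mark'' (Var ''r'') (Plus (Var ''k'') (Const 1))) count_row) ?Q
          (t' + 6 + (1 + cost (Times (Adj ''c'' ''r'') (Minus (Const 1) (Cell ''mark'' (Var ''r'')))))) s'"
      proof (intro wp_Seq wp_Assign)
        let ?s = "s'(''mark'' := (s' ''mark'')(val (Var ''r'') s' := val (Plus (Var ''k'') (Const 1)) s'))"
        have s1: "?s = s'(''mark'' := (s' ''mark'')(i := Suc k))" using i ck by simp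
        show "wp W count_row ?Q (t' + 6
            + (1 + cost (Times (Adj ''c'' ''r'') (Minus (Const 1) (Cell ''mark'' (Var ''r'')))))
            + (1 + cost (Var ''r'') + cost (Plus (Var ''k'') (Const 1)))) ?s"
          unfolding s1
        proof (rule wp_count_row)
          show "adjacency N E (s'(''mark'' := (s' ''mark'')(i := Suc k)))"
            using adj unfolding adjacency_def by simp
          fix t2 s2
          assume t2: "t2 \<le> t' + 6
              + (1 + cost (Times (Adj ''c'' ''r'') (Minus (Const 1) (Cell ''mark'' (Var ''r'')))))
              + (1 + cost (Var ''r'') + cost (Plus (Var ''k'') (Const 1))) + 40 * N + 10"
            and a2: "agree {''j'', ''cnt''} (s'(''mark'' := (s' ''mark'')(i := Suc k))) s2"
            and c2: "\<And>j. j < N \<Longrightarrow> s2 ''cnt'' j =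
              (s'(''mark'' := (s' ''mark'')(i := Suc k))) ''cnt'' j + (if E i j then 1 else 0)"
          have "agree {''r'', ''j'', ''cnt'', ''mark''} s s2"
            using ag a2 unfolding agree_def by auto
          moreover have "s2 ''r'' 0 = i" "s2 ''n'' 0 = N" "s2 ''mark'' = (s' ''mark'')(i := Suc k)"
            using a2 i unfolding agree_def by auto
          moreover have "t2 + 6 \<le> t + 60 * Suc i + 3 + card (?new (Suc i)) * (40 * N + 40)"
          proof -
            have "t2 \<le> t' + 40 * N + 40" using t2 by simp
            moreover have "card (?new (Suc i)) * (40 * N + 40)
                = card (?new i) * (40 * N + 40) + (40 * N + 40)"
              using nS new by simp
            \<comment> \<open>The products are replaced by variables, which leaves a linear
              claim.\<close>
            moreover have "t2 + 6 \<le> t + 60 * Suc i + 3 + A'"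
              if "t2 \<le> t' + 40 * N + 40" "A' = A + (40 * N + 40)" "t' \<le> t + 60 * i + 3 + A"
              for A A' using that by simp
            ultimately show ?thesis using conjunct1[OF I] by blast
          qed
          ultimately show "?Q t2 s2"
            using I c2 cS new i(1) by (auto simp: less_Suc_eq)
        qed (use i cnt' s(5) in auto)
      qed (use W_bounds i ck s in auto)
    next
      assume "val (Times (Adj ''c'' ''r'') (Minus (Const 1) (Cell ''mark'' (Var ''r'')))) s' = 0"
      then have "\<not> (E c i \<and> s ''mark'' i = 0)" using i ck adjc mi by auto
      then show "wp W Skip ?Q (t' + 6 + (1 + cost (Times (Adj ''c'' ''r'') (Minus (Const 1) (Cell ''mark'' (Var ''r'')))))) s'"
        using I i cS nS by (intro wp_intros) (auto simp: less_Suc_eq)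
    qed
  qed (use W_bounds s Q in \<open>auto simp: adjacency_def\<close>)
qed

lemma wp_select_column:
  assumes s: "adjacency N E s" "s ''b'' 0 = 0"
    and used: "\<And>j. j < N \<Longrightarrow> s ''used'' j \<le> 1" "u < N" "s ''used'' u = 0"
    and cnt: "\<And>j. j < N \<Longrightarrow> s ''cnt'' j \<le> N"
    and Q: "\<And>t' s' c. \<lbrakk>t' \<le> t + 60 * N + 10; agree {''j'', ''b'', ''c''} s s';
       s' ''c'' 0 = c; c < N; s ''used'' c = 0;
       \<And>j. j < N \<Longrightarrow> s ''used'' j = 0 \<Longrightarrow> s ''cnt'' j \<le> s ''cnt'' c\<rbrakk> \<Longrightarrow> Q t' s'"
  shows "wp W select_column Q t s"
proof -
  let ?best = "\<lambda>k s'. (s' ''b'' 0 = 0 \<and> (\<forall>j<k. s ''used'' j \<noteq> 0)) \<or>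
    (s' ''c'' 0 < N \<and> s ''used'' (s' ''c'' 0) = 0 \<and> s' ''b'' 0 = s ''cnt'' (s' ''c'' 0) + 1 \<and>
     (\<forall>j<k. s ''used'' j = 0 \<longrightarrow> s ''cnt'' j \<le> s ''cnt'' (s' ''c'' 0)))"
  let ?I = "\<lambda>k t' s'. t' \<le> t + 60 * k + 3 \<and> agree {''j'', ''b'', ''c''} s s' \<and> ?best k s'"
  show ?thesis
    unfolding select_column_def
  proof (rule wp_For[where N = N and I = ?I])
    fix k t' s'
    assume k: "k < N" "s' ''j'' 0 = k" "s' ''n'' 0 = N" and I: "?I k t' s'"
    have eq: "s' ''used'' = s ''used''" "s' ''cnt'' = s ''cnt''" using I by (auto simp: agree_def)
    have b: "s' ''b'' 0 \<le> N + 1" using I cnt by fastforce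
    note bk = used(1)[OF k(1)] cnt[OF k(1)]
    let ?Q = "\<lambda>t s. s ''j'' 0 = k \<and> s ''n'' 0 = N \<and> ?I (Suc k) (t + 6) (s(''j'' := (s ''j'')(0 := Suc k)))"
    let ?upd = "Seq (Assign ''b'' (Const 0) (Plus (Cell ''cnt'' (Var ''j'')) (Const 1)))
           (Assign ''c'' (Const 0) (Var ''j''))"
    let ?b = "Minus (Plus (Cell ''cnt'' (Var ''j'')) (Const 1)) (Var ''b'')"
    show "wp W (If (Cell ''used'' (Var ''j'')) Skip (If ?b ?upd Skip)) ?Q (t' + 6) s'"
    proof (intro wp_If)
      assume "val (Cell ''used'' (Var ''j'')) s' \<noteq> 0"
      then have "s ''used'' k \<noteq> 0" using k eq by simp
      then have "?best (Suc k) s'" using I by (auto simp: less_Suc_eq)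
      then show "wp W Skip ?Q (t' + 6 + (1 + cost (Cell ''used'' (Var ''j'')))) s'"
        using I k by (intro wp_intros) auto
    next
      assume "val (Cell ''used'' (Var ''j'')) s' = 0" and b: "val ?b s' \<noteq> 0"
      then have new: "s ''used'' k = 0" using k eq by simp
      have "s' ''b'' 0 < s ''cnt'' k + 1" using b k eq by simp
      then have "\<forall>j<Suc k. s ''used'' j = 0 \<longrightarrow> s ''cnt'' j \<le> s ''cnt'' k"
        using I by (fastforce simp: less_Suc_eq)
      then show "wp W ?upd ?Q (t' + 6 + (1 + cost (Cell ''used'' (Var ''j''))) + (1 + cost ?b)) s'"
        using I k eq new bk W_bounds by (intro wp_intros) auto
    next
      assume "val (Cell ''used'' (Var ''j'')) s' = 0" and b: "val ?b s' = 0"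
      then have new: "s ''used'' k = 0" using k eq by simp
      have "s ''cnt'' k + 1 \<le> s' ''b'' 0" using b k eq by simp
      then have "?best (Suc k) s'" using I by (auto simp: less_Suc_eq)
      then show "wp W Skip ?Q (t' + 6 + (1 + cost (Cell ''used'' (Var ''j''))) + (1 + cost ?b)) s'"
        using I k by (intro wp_intros) auto
    qed (use k eq b bk W_bounds in auto)
  next
    fix t' s' assume "?I N t' s'"
    moreover from this have "?best N s'" by blast
    then have "s' ''c'' 0 < N" "s ''used'' (s' ''c'' 0) = 0"
      "\<And>j. j < N \<Longrightarrow> s ''used'' j = 0 \<Longrightarrow> s ''cnt'' j \<le> s ''cnt'' (s' ''c'' 0)"
      using used(2,3) by auto
    ultimately show "Q (t' + 6) s'" by (intro Q[of _ s' "s' ''c'' 0"]) auto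
  qed (use W_bounds s in \<open>auto simp: adjacency_def\<close>)
qed

lemma wp_dominate_column:
  assumes s: "adjacency N E s" "s ''c'' 0 = c" "c < N"
    and Q: "\<And>t' s'. \<lbrakk>t' \<le> t + 60 * N + 10; agree {''r'', ''dom''} s s';
       \<And>r. r < N \<Longrightarrow> s' ''dom'' r = (if E c r then 1 else s ''dom'' r)\<rbrakk> \<Longrightarrow> Q t' s'"
  shows "wp W dominate_column Q t s"
  unfolding dominate_column_def
proof (rule wp_For[where N = N and I = "\<lambda>k t' s'. t' \<le> t + 60 * k + 3 \<and> agree {''r'', ''dom''} s s' \<and>
    (\<forall>r<N. s' ''dom'' r = (if r < k \<and> E c r then 1 else s ''dom'' r))"])
  fix k t' s'
  assume k: "k < N" "s' ''r'' 0 = k" "s' ''n'' 0 = N"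
    and I: "t' \<le> t + 60 * k + 3 \<and> agree {''r'', ''dom''} s s' \<and>
      (\<forall>r<N. s' ''dom'' r = (if r < k \<and> E c r then 1 else s ''dom'' r))"
  have c: "s' ''c'' 0 = c" and adj: "s' ''adj'' (c * N + k) = (if E c k then 1 else 0)"
    using I s k(1) by (auto simp: agree_def adjacency_def)
  show "wp W (If (Adj ''c'' ''r'') (Assign ''dom'' (Var ''r'') (Const 1)) Skip)
     (\<lambda>t' s'. s' ''r'' 0 = k \<and> s' ''n'' 0 = N \<and> t' + 6 \<le> t + 60 * Suc k + 3 \<and>
       agree {''r'', ''dom''} s (s'(''r'' := (s' ''r'')(0 := Suc k))) \<and>
       (\<forall>r<N. (s'(''r'' := (s' ''r'')(0 := Suc k))) ''dom'' r
          = (if r < Suc k \<and> E c r then 1 else s ''dom'' r))) (t' + 6) s'"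
    using k I c adj s(3) W_bounds by (intro wp_intros) (auto simp: less_Suc_eq split: if_splits)
qed (use W_bounds s Q in \<open>auto simp: adjacency_def\<close>)

lemma wp_test_column:
  assumes s: "s ''n'' 0 = N" "s ''k'' 0 = k" "k < N" "s ''b'' 0 = 0"
    and mark: "\<And>r. r < N \<Longrightarrow> s ''mark'' r \<le> N" "\<And>r. r < N \<Longrightarrow> s ''dom'' r \<le> 1"
    and Q: "\<And>t' s'. \<lbrakk>t' \<le> t + 80 * N + 10; agree {''r'', ''b''} s s'; s' ''b'' 0 < W;
       s' ''b'' 0 \<noteq> 0 \<longleftrightarrow> (\<exists>r<N. s ''mark'' r = N - k \<and> s ''dom'' r = 0)\<rbrakk> \<Longrightarrow> Q t' s'"
  shows "wp W test_column Q t s"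
  unfolding test_column_def
proof (rule wp_For[where N = N and I = "\<lambda>i t' s'. t' \<le> t + 80 * i + 3 \<and> agree {''r'', ''b''} s s' \<and> s' ''b'' 0 \<le> 1 \<and>
    (s' ''b'' 0 \<noteq> 0 \<longleftrightarrow> (\<exists>r<i. s ''mark'' r = N - k \<and> s ''dom'' r = 0))"])
  fix i t' s'
  assume i: "i < N" "s' ''r'' 0 = i" "s' ''n'' 0 = N"
    and I: "t' \<le> t + 80 * i + 3 \<and> agree {''r'', ''b''} s s' \<and> s' ''b'' 0 \<le> 1 \<and>
    (s' ''b'' 0 \<noteq> 0 \<longleftrightarrow> (\<exists>r<i. s ''mark'' r = N - k \<and> s ''dom'' r = 0))"
  have eq: "s' ''k'' 0 = k" "s' ''mark'' = s ''mark''" "s' ''dom'' = s ''dom''"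
    using I s by (auto simp: agree_def)
  have mi: "s ''mark'' i \<le> N" "s ''dom'' i \<le> 1" using mark i by auto
  have test: "(Suc 0 - d) * ((Suc 0 - (a - b)) * (Suc 0 - (b - a))) \<noteq> 0 \<longleftrightarrow> a = b \<and> d = 0" for a b d :: nat
    by auto
  let ?b = "Times (Minus (Const 1) (Cell ''dom'' (Var ''r'')))
           (Times (Minus (Const 1) (Minus (Cell ''mark'' (Var ''r'')) (Minus (Var ''n'') (Var ''k''))))
             (Minus (Const 1) (Minus (Minus (Var ''n'') (Var ''k'')) (Cell ''mark'' (Var ''r'')))))"
  have vb: "val ?b s' \<noteq> 0 \<longleftrightarrow> s ''mark'' i = N - k \<and> s ''dom'' i = 0"
    using test[of "s ''dom'' i" "s ''mark'' i" "N - k"] i eq by simp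
  \<comment> \<open>Every factor is 0 or 1, so the products respect the word bound.\<close>
  have le1: "(Suc 0 - a) * (Suc 0 - b) < W" "(Suc 0 - a) * ((Suc 0 - b) * (Suc 0 - c)) < W" for a b c :: nat
    using W_bounds(1) by (cases a; cases b; cases c; simp)+
  have fb: "fits W ?b s'"
    using i eq mi le1 W_bounds s by auto
  show "wp W (If ?b (Assign ''b'' (Const 0) (Const 1)) Skip)
     (\<lambda>t' s'. s' ''r'' 0 = i \<and> s' ''n'' 0 = N \<and> t' + 6 \<le> t + 80 * Suc i + 3 \<and>
       agree {''r'', ''b''} s (s'(''r'' := (s' ''r'')(0 := Suc i))) \<and>
       (s'(''r'' := (s' ''r'')(0 := Suc i))) ''b'' 0 \<le> 1 \<and>
       ((s'(''r'' := (s' ''r'')(0 := Suc i))) ''b'' 0 \<noteq> 0 \<longleftrightarrow>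
         (\<exists>r<Suc i. s ''mark'' r = N - k \<and> s ''dom'' r = 0))) (t' + 6) s'"
  proof (rule wp_If[OF fb])
    assume "val ?b s' \<noteq> 0"
    then have "\<exists>r<Suc i. s ''mark'' r = N - k \<and> s ''dom'' r = 0" using vb by blast
    then show "wp W (Assign ''b'' (Const 0) (Const 1))
     (\<lambda>t' s'. s' ''r'' 0 = i \<and> s' ''n'' 0 = N \<and> t' + 6 \<le> t + 80 * Suc i + 3 \<and>
       agree {''r'', ''b''} s (s'(''r'' := (s' ''r'')(0 := Suc i))) \<and>
       (s'(''r'' := (s' ''r'')(0 := Suc i))) ''b'' 0 \<le> 1 \<and>
       ((s'(''r'' := (s' ''r'')(0 := Suc i))) ''b'' 0 \<noteq> 0 \<longleftrightarrow>
         (\<exists>r<Suc i. s ''mark'' r = N - k \<and> s ''dom'' r = 0))) (t' + 6 + (1 + cost ?b)) s'"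
      using i I W_bounds by (intro wp_intros) auto
  next
    assume "val ?b s' = 0"
    then have "(\<exists>r<Suc i. s ''mark'' r = N - k \<and> s ''dom'' r = 0) \<longleftrightarrow>
        (\<exists>r<i. s ''mark'' r = N - k \<and> s ''dom'' r = 0)" using vb less_Suc_eq by auto
    then show "wp W Skip
     (\<lambda>t' s'. s' ''r'' 0 = i \<and> s' ''n'' 0 = N \<and> t' + 6 \<le> t + 80 * Suc i + 3 \<and>
       agree {''r'', ''b''} s (s'(''r'' := (s' ''r'')(0 := Suc i))) \<and>
       (s'(''r'' := (s' ''r'')(0 := Suc i))) ''b'' 0 \<le> 1 \<and>
       ((s'(''r'' := (s' ''r'')(0 := Suc i))) ''b'' 0 \<noteq> 0 \<longleftrightarrow>
         (\<exists>r<Suc i. s ''mark'' r = N - k \<and> s ''dom'' r = 0))) (t' + 6 + (1 + cost ?b)) s'"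
      using i I W_bounds by (intro wp_intros) auto
  qed
next
  fix t' s' assume "t' \<le> t + 80 * N + 3 \<and> agree {''r'', ''b''} s s' \<and> s' ''b'' 0 \<le> 1 \<and>
    (s' ''b'' 0 \<noteq> 0 \<longleftrightarrow> (\<exists>r<N. s ''mark'' r = N - k \<and> s ''dom'' r = 0))"
  then show "Q (t' + 6) s'" using W_bounds(1) by (intro Q) auto
qed (use W_bounds s in auto)

lemma wp_add_isolated:
  assumes s: "s ''n'' 0 = N" "s ''out'' 0 \<le> N"
    and mark: "\<And>r. r < N \<Longrightarrow> s ''mark'' r \<le> N"
    and Q: "\<And>t' s'. \<lbrakk>t' \<le> t + 40 * N + 10;
       s' ''out'' 0 = s ''out'' 0 + card {r. r < N \<and> s ''mark'' r = 0}\<rbrakk> \<Longrightarrow> Q t' s'"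
  shows "wp W add_isolated Q t s"
  unfolding add_isolated_def
proof (rule wp_For[where N = N and I = "\<lambda>k t' s'. t' \<le> t + 40 * k + 3 \<and> agree {''r'', ''out''} s s' \<and>
    s' ''out'' 0 = s ''out'' 0 + card {r. r < k \<and> s ''mark'' r = 0}"])
  fix k t' s'
  assume k: "k < N" "s' ''r'' 0 = k" "s' ''n'' 0 = N"
    and I: "t' \<le> t + 40 * k + 3 \<and> agree {''r'', ''out''} s s' \<and>
    s' ''out'' 0 = s ''out'' 0 + card {r. r < k \<and> s ''mark'' r = 0}"
  have eq: "s' ''mark'' = s ''mark''" using I by (auto simp: agree_def)
  have "card {r. r < k \<and> s ''mark'' r = 0} \<le> card {..<k}" by (intro card_mono) auto
  then have out: "s' ''out'' 0 \<le> 2 * N" using I s(2) k(1) by auto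
  have S: "card {r. r < Suc k \<and> s ''mark'' r = 0}
      = card {r. r < k \<and> s ''mark'' r = 0} + (if s ''mark'' k = 0 then 1 else 0)"
    by (rule card_Collect_Suc)
  show "wp W (If (Cell ''mark'' (Var ''r'')) Skip
       (Assign ''out'' (Const 0) (Plus (Var ''out'') (Const 1))))
     (\<lambda>t' s'. s' ''r'' 0 = k \<and> s' ''n'' 0 = N \<and> t' + 6 \<le> t + 40 * Suc k + 3 \<and>
       agree {''r'', ''out''} s (s'(''r'' := (s' ''r'')(0 := Suc k))) \<and>
       (s'(''r'' := (s' ''r'')(0 := Suc k))) ''out'' 0
         = s ''out'' 0 + card {r. r < Suc k \<and> s ''mark'' r = 0}) (t' + 6) s'"
    unfolding S
    using k I eq mark[OF k(1)] out W by (intro wp_intros) auto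
qed (use W_bounds s Q in auto)

text \<open>
  \<open>mark r\<close> is 0 for an uncovered row and \<open>Suc i\<close> for a row that is first covered by column \<open>c i\<close>.
\<close>

definition search_state ::
  "nat \<Rightarrow> (nat \<Rightarrow> nat) \<Rightarrow> (nat \<Rightarrow> nat) \<Rightarrow> (nat \<Rightarrow> nat) \<Rightarrow> (nat \<Rightarrow> nat) \<Rightarrow> bool" where
  "search_state k c used mark cnt \<longleftrightarrow> mcs_order {..<N} E k c \<and>
     (\<forall>j<N. used j = (if j \<in> c ` {..<k} then 1 else 0)) \<and>
     (\<forall>r<N. mark r = 0 \<and> r \<notin> marked E c k \<or>
        (\<exists>i<k. mark r = Suc i \<and> E (c i) r \<and> r \<notin> marked E c i)) \<and>
     (\<forall>j<N. cnt j = card {r \<in> marked E c k. E j r})"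

context
  assumes sym: "\<And>u v. E u v \<Longrightarrow> E v u" and bounded: "\<And>u v. E u v \<Longrightarrow> u < N"
begin

section \<open>The search invariant and the two passes\<close>

lemma marked_bounded: "marked E c k \<subseteq> {..<N}"
  using bounded sym by (auto simp: marked_def)

lemma card_marked_le: "card {r \<in> marked E c k. P r} \<le> N"
  using card_mono[of "{..<N}" "{r \<in> marked E c k. P r}"] marked_bounded by fastforce

lemma finite_marked_bounded [simp]: "finite (marked E c k)"
  using marked_bounded finite_subset by blast

lemma search_state_marked:
  assumes "search_state k c used mark cnt" "r < N"
  shows "mark r = 0 \<longleftrightarrow> r \<notin> marked E c k"
  using assms unfolding search_state_def marked_def by fastforce

text \<open>Of two candidates the earlier one already covers the row, so first covers are unique.
  Hence the backward pass can recognise witnesses from the marks alone.\<close>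

lemma search_state_first:
  assumes st: "search_state k c used mark cnt" "r < N" and i: "i < k"
  shows "mark r = Suc i \<longleftrightarrow> E (c i) r \<and> r \<notin> marked E c i"
proof
  assume "mark r = Suc i"
  then show "E (c i) r \<and> r \<notin> marked E c i" using st unfolding search_state_def by auto
next
  assume *: "E (c i) r \<and> r \<notin> marked E c i"
  then have "r \<in> marked E c k" using i unfolding marked_def by blast
  then obtain j where j: "mark r = Suc j" "E (c j) r" "r \<notin> marked E c j"
    using st unfolding search_state_def by blast
  then have "\<not> i < j" "\<not> j < i" using * unfolding marked_def by blast+
  then show "mark r = Suc i" using j by simp
qed

lemma search_state_cnt_le: "search_state k c used mark cnt \<Longrightarrow> j < N \<Longrightarrow> cnt j \<le> N"
  using card_marked_le unfolding search_state_def by simp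

text \<open>The neighbours of \<open>v\<close> with mark 0 are exactly the newly covered rows, so
  counters and covered set grow by disjoint unions. The second claim feeds the time bound.\<close>

lemma search_state_Suc:
  assumes st: "search_state k c used mark cnt" and k: "k < N"
    and v: "v < N" "used v = 0" "\<And>j. j < N \<Longrightarrow> used j = 0 \<Longrightarrow> cnt j \<le> cnt v"
    and mark': "\<And>r. r < N \<Longrightarrow> mark' r = (if E v r \<and> mark r = 0 then k + 1 else mark r)"
    and cnt': "\<And>j. j < N \<Longrightarrow> cnt' j = cnt j + card {r. r < N \<and> E v r \<and> mark r = 0 \<and> E r j}"
  shows "search_state (Suc k) (c(k := v)) (used(v := 1)) mark' cnt'"
    and "card (marked E (c(k := v)) (Suc k)) = card (marked E c k) + card {r. r < N \<and> E v r \<and> mark r = 0}"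
proof -
  let ?c = "c(k := v)"
  let ?new = "{r. r < N \<and> E v r \<and> mark r = 0}"
  have mk: "marked E ?c t = marked E c t" if "t \<le> k" for t
    using that by (intro marked_cong) auto
  have m0: "mark r = 0 \<longleftrightarrow> r \<notin> marked E c k" if "r < N" for r
    using search_state_marked[OF st that] .
  have mS: "marked E ?c (Suc k) = marked E c k \<union> ?new"
  proof -
    have "r < N" if "E v r" for r using bounded sym that by blast
    then show ?thesis using m0 mk[of k] by (auto simp: marked_Suc)
  qed
  have disj: "marked E c k \<inter> ?new = {}" using m0 by auto
  show "card (marked E ?c (Suc k)) = card (marked E c k) + card ?new"
    unfolding mS using disj by (intro card_Un_disjoint) auto
  have used_iff: "used j = 0 \<longleftrightarrow> j \<notin> c ` {..<k}" if "j < N" for j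
    using st that unfolding search_state_def by auto
  have img: "?c ` {..<Suc k} = insert v (c ` {..<k})"
    by (auto simp: lessThan_Suc)
  show "search_state (Suc k) ?c (used(v := 1)) mark' cnt'"
    unfolding search_state_def
  proof (intro conjI allI impI)
    show "mcs_order {..<N} E (Suc k) ?c"
    proof (rule mcs_order_Suc)
      show "mcs_order {..<N} E k c" using st unfolding search_state_def by blast
      show "v \<in> {..<N} - c ` {..<k}" using v used_iff by auto
      fix u assume u: "u \<in> {..<N} - c ` {..<k}"
      then have "cnt u \<le> cnt v" using v(3)[of u] used_iff[of u] by simp
      then show "card {r \<in> marked E c k. E u r} \<le> card {r \<in> marked E c k. E v r}"
        using st u v(1) unfolding search_state_def by simp
    qed
    show "(used(v := 1)) j = (if j \<in> ?c ` {..<Suc k} then 1 else 0)" if "j < N" for j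
      using st that unfolding img search_state_def by auto
    show "mark' r = 0 \<and> r \<notin> marked E ?c (Suc k) \<or>
        (\<exists>i<Suc k. mark' r = Suc i \<and> E (?c i) r \<and> r \<notin> marked E ?c i)" if r: "r < N" for r
    proof -
      consider "E v r" "mark r = 0" | "\<not> E v r" "mark r = 0" | "mark r \<noteq> 0" by blast
      then show ?thesis
      proof cases
        case 1
        then show ?thesis using mark'[OF r] m0[OF r] mk[of k] by auto
      next
        case 2
        then show ?thesis using mark'[OF r] m0[OF r] mS by auto
      next
        case 3
        then obtain i where i: "i < k" "mark r = Suc i" "E (c i) r" "r \<notin> marked E c i"
          using st r unfolding search_state_def by auto
        then have "i < Suc k" "mark' r = Suc i" "E (?c i) r" "r \<notin> marked E ?c i"
          using mark'[OF r] mk[of i] by auto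
        then show ?thesis by blast
      qed
    qed
    show "cnt' j = card {r \<in> marked E ?c (Suc k). E j r}" if j: "j < N" for j
    proof -
      \<comment> \<open>The program scans the matrix row of \<open>r\<close> and adds
        \<open>E r j\<close>, while the counter is to count \<open>E j r\<close>; symmetry
        reconciles the two.\<close>
      have "{r \<in> marked E ?c (Suc k). E j r} = {r \<in> marked E c k. E j r} \<union>
          {r. r < N \<and> E v r \<and> mark r = 0 \<and> E r j}"
        unfolding mS using sym by blast
      moreover have "{r \<in> marked E c k. E j r} \<inter> {r. r < N \<and> E v r \<and> mark r = 0 \<and> E r j} = {}"
        using m0 by auto
      ultimately have "card {r \<in> marked E ?c (Suc k). E j r} = card {r \<in> marked E c k. E j r} +
          card {r. r < N \<and> E v r \<and> mark r = 0 \<and> E r j}"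
        by (simp add: card_Un_disjoint)
      then show ?thesis using cnt'[OF j] st j unfolding search_state_def by simp
    qed
  qed
qed

lemma wp_search:
  assumes s: "adjacency N E s"
    and zero: "\<And>j. s ''used'' j = 0" "\<And>r. s ''mark'' r = 0" "\<And>j. s ''cnt'' j = 0"
    and Q: "\<And>t' s'. \<lbrakk>t' \<le> t + 300 * (N + 1) * (N + 1);
       agree {''k'', ''b'', ''j'', ''c'', ''used'', ''ord'', ''r'', ''cnt'', ''mark''} s s';
       search_state N (s' ''ord'') (s' ''used'') (s' ''mark'') (s' ''cnt'')\<rbrakk> \<Longrightarrow> Q t' s'"
  shows "wp W search Q t s"
proof -
  let ?X = "{''k'', ''b'', ''j'', ''c'', ''used'', ''ord'', ''r'', ''cnt'', ''mark''}"
  let ?st = "\<lambda>k s'. search_state k (s' ''ord'') (s' ''used'') (s' ''mark'') (s' ''cnt'')"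
  \<comment> \<open>A potential: a linear amount per selected column plus \<open>40 * N + 40\<close>
    per covered row. At most \<open>N\<close> rows are ever covered, so the total is quadratic
    although a single round may already take quadratic time.\<close>
  let ?I = "\<lambda>k t' s'. t' \<le> t + (120 * N + 100) * k + 3 + card (marked E (s' ''ord'') k) * (40 * N + 40) \<and>
    agree ?X s s' \<and> ?st k s'"
  show ?thesis
    unfolding search_def
  proof (rule wp_For[where N = N and I = ?I])
    have "?st 0 s" using zero unfolding search_state_def mcs_order_def by simp
    then show "?I 0 (t + 3) (s(''k'' := (s ''k'')(0 := 0)))" by simp
  next
    fix k t' s'
    assume k: "k < N" "s' ''k'' 0 = k" "s' ''n'' 0 = N" and I: "?I k t' s'"
    have ag: "agree ?X s s'" and st: "?st k s'" using I by blast+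
    have adj: "adjacency N E s'" using s ag by (auto simp: agree_def adjacency_def)
    let ?Q = "\<lambda>t s. s ''k'' 0 = k \<and> s ''n'' 0 = N \<and> ?I (Suc k) (t + 6) (s(''k'' := (s ''k'')(0 := Suc k)))"
    show "wp W (Seq (Assign ''b'' (Const 0) (Const 0)) (Seq select_column
       (Seq (Assign ''used'' (Var ''c'') (Const 1)) (Seq (Assign ''ord'' (Var ''k'') (Var ''c''))
       mark_column)))) ?Q (t' + 6) s'"
    proof (intro wp_Seq wp_Assign)
      have "card (s' ''ord'' ` {..<k}) < card {..<N}"
        using card_image_le[of "{..<k}" "s' ''ord''"] k(1) by simp
      then have "\<not> {..<N} \<subseteq> s' ''ord'' ` {..<k}" using card_mono[of "s' ''ord'' ` {..<k}" "{..<N}"] by auto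
      then obtain u where "u < N" "u \<notin> s' ''ord'' ` {..<k}" by auto
      then have u: "u < N" "s' ''used'' u = 0" using st unfolding search_state_def by auto
      let ?s = "s'(''b'' := (s' ''b'')(val (Const 0) s' := val (Const 0) s'))"
      show "wp W select_column (wp W (Seq (Assign ''used'' (Var ''c'') (Const 1))
          (Seq (Assign ''ord'' (Var ''k'') (Var ''c'')) mark_column)) ?Q)
          (t' + 6 + (1 + cost (Const 0) + cost (Const 0))) ?s"
      proof (rule wp_select_column[where u = u])
        fix t1 s1 c
        assume t1: "t1 \<le> t' + 6 + (1 + cost (Const 0) + cost (Const 0)) + 60 * N + 10"
          and a1: "agree {''j'', ''b'', ''c''} ?s s1" and c: "s1 ''c'' 0 = c" "c < N" "?s ''used'' c = 0"
          and max: "\<And>j. j < N \<Longrightarrow> ?s ''used'' j = 0 \<Longrightarrow> ?s ''cnt'' j \<le> ?s ''cnt'' c"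
        have eq1: "s1 ''used'' = s' ''used''" "s1 ''cnt'' = s' ''cnt''" "s1 ''mark'' = s' ''mark''"
          "s1 ''ord'' = s' ''ord''" "s1 ''k'' 0 = k"
          using a1 k by (auto simp: agree_def)
        let ?u = "s1(''used'' := (s1 ''used'')(c := 1))"
        let ?o = "?u(''ord'' := (s1 ''ord'')(k := c))"
        let ?t = "t1 + (1 + cost (Var ''c'') + cost (Const 1)) + (1 + cost (Var ''k'') + cost (Var ''c''))"
        have step: "search_state (Suc k) ((s' ''ord'')(k := c)) ((s' ''used'')(c := 1)) mark' cnt'"
          "card (marked E ((s' ''ord'')(k := c)) (Suc k)) = card (marked E (s' ''ord'') k)
             + card {r. r < N \<and> E c r \<and> s' ''mark'' r = 0}"
          if "\<And>r. r < N \<Longrightarrow> mark' r = (if E c r \<and> s' ''mark'' r = 0 then k + 1 else s' ''mark'' r)"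
            "\<And>j. j < N \<Longrightarrow> cnt' j = s' ''cnt'' j + card {r. r < N \<and> E c r \<and> s' ''mark'' r = 0 \<and> E r j}"
          for mark' cnt'
          using search_state_Suc[OF st k(1) c(2) _ _ that] c max by auto
        have mark_lt: "s' ''mark'' r < W" if "r < N" for r
        proof -
          have "s' ''mark'' r \<le> k" using st that unfolding search_state_def by fastforce
          then show ?thesis using k(1) W_bounds by linarith
        qed
        have "wp W mark_column ?Q ?t ?o"
        proof (rule wp_mark_column[where c = c and k = k])
          show "adjacency N E ?o" using adj a1 by (auto simp: adjacency_def agree_def)
          show "?o ''c'' 0 = c" "c < N" "?o ''k'' 0 = k" "k < N" using c eq1 k by auto
          show "?o ''mark'' r < W" if "r < N" for r using mark_lt[OF that] eq1 by simp
          \<comment> \<open>The counters after the call belong to the next search state, hence count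
            rows below \<open>N\<close>. That state is formed in advance from the expected marks and
            counters.\<close>
          show "?o ''cnt'' j + card {r. r < N \<and> E c r \<and> ?o ''mark'' r = 0 \<and> E r j} \<le> N" if "j < N" for j
            using search_state_cnt_le[OF step(1)[of "\<lambda>r. if E c r \<and> s' ''mark'' r = 0 then k + 1 else s' ''mark'' r"
              "\<lambda>j. s' ''cnt'' j + card {r. r < N \<and> E c r \<and> s' ''mark'' r = 0 \<and> E r j}"] that] eq1 by simp
          fix t2 s2
          assume t2: "t2 \<le> ?t + 60 * N + 10 + card {r. r < N \<and> E c r \<and> ?o ''mark'' r = 0} * (40 * N + 40)"
            and a2: "agree {''r'', ''j'', ''cnt'', ''mark''} ?o s2"
            and c2: "\<And>j. j < N \<Longrightarrow> s2 ''cnt'' j = ?o ''cnt'' j +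
              card {r. r < N \<and> E c r \<and> ?o ''mark'' r = 0 \<and> E r j}"
            and m2: "\<And>r. r < N \<Longrightarrow> s2 ''mark'' r =
              (if E c r \<and> ?o ''mark'' r = 0 then k + 1 else ?o ''mark'' r)"
          have eq2: "s2 ''ord'' = (s' ''ord'')(k := c)" "s2 ''used'' = (s' ''used'')(c := 1)"
            "s2 ''k'' 0 = k" "s2 ''n'' 0 = N"
            using a2 a1 k eq1 by (auto simp: agree_def)
          have st2: "search_state (Suc k) (s2 ''ord'') (s2 ''used'') (s2 ''mark'') (s2 ''cnt'')"
            and cd2: "card (marked E (s2 ''ord'') (Suc k)) = card (marked E (s' ''ord'') k)
             + card {r. r < N \<and> E c r \<and> s' ''mark'' r = 0}"
            unfolding eq2 using step[of "s2 ''mark''" "s2 ''cnt''"] m2 c2 eq1 by auto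
          have "agree ?X s s2" using ag a1 a2 unfolding agree_def by auto
          moreover have "t2 + 6 \<le> t + (120 * N + 100) * Suc k + 3 +
              card (marked E (s2 ''ord'') (Suc k)) * (40 * N + 40)"
          proof -
            have "t2 \<le> t' + 120 * N + 60 + card {r. r < N \<and> E c r \<and> s' ''mark'' r = 0} * (40 * N + 40)"
              using t1 t2 eq1 by simp
            moreover have "card (marked E (s2 ''ord'') (Suc k)) * (40 * N + 40) =
              card (marked E (s' ''ord'') k) * (40 * N + 40) +
              card {r. r < N \<and> E c r \<and> s' ''mark'' r = 0} * (40 * N + 40)"
              unfolding cd2 by (rule add_mult_distrib)
            moreover have "(120 * N + 100) * Suc k = (120 * N + 100) * k + (120 * N + 100)" by simp
            ultimately show ?thesis using conjunct1[OF I] by linarith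
          qed
          ultimately show "?Q t2 s2" using st2 eq2 by simp
        qed
        then show "wp W (Seq (Assign ''used'' (Var ''c'') (Const 1))
          (Seq (Assign ''ord'' (Var ''k'') (Var ''c'')) mark_column)) ?Q t1 s1"
          using c k(1) eq1 W_bounds by (intro wp_Seq wp_Assign) (simp_all add: fun_upd_def cong: if_cong)
      next
        show "adjacency N E ?s" using adj by (auto simp: adjacency_def)
        show "?s ''used'' j \<le> 1" if "j < N" for j using st that by (simp add: search_state_def)
        show "?s ''cnt'' j \<le> N" if "j < N" for j using search_state_cnt_le[OF st that] by simp
      qed (use u in auto)
    qed (use W_bounds in auto)
  next
    fix t' s' assume I: "?I N t' s'"
    have "card (marked E (s' ''ord'') N) \<le> N"
      using card_marked_le[of "s' ''ord''" N "\<lambda>_. True"] by simp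
    then have "card (marked E (s' ''ord'') N) * (40 * N + 40) \<le> N * (40 * N + 40)"
      by (rule mult_le_mono1)
    moreover have "(120 * N + 100) * N + N * (40 * N + 40) + 9 \<le> 300 * (N + 1) * (N + 1)"
      by (simp add: algebra_simps)
    ultimately have "t' + 6 \<le> t + 300 * (N + 1) * (N + 1)" using conjunct1[OF I] by linarith
    then show "Q (t' + 6) s'" using I by (intro Q) blast+
  qed (use W_bounds s in \<open>auto simp: adjacency_def\<close>)
qed

lemma wp_choose_columns:
  assumes s: "adjacency N E s" "s ''out'' 0 = 0" "\<And>r. s ''dom'' r = 0"
    and st: "search_state N (s ''ord'') (s ''used'') (s ''mark'') (s ''cnt'')"
    and Q: "\<And>t' s' K. \<lbrakk>t' \<le> t + 300 * (N + 1) * (N + 1);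
       agree {''k'', ''c'', ''b'', ''r'', ''dom'', ''out''} s s';
       greedy_choice E (s ''ord'') 0 N K; s' ''out'' 0 = card K\<rbrakk> \<Longrightarrow> Q t' s'"
  shows "wp W choose_columns Q t s"
proof -
  let ?X = "{''k'', ''c'', ''b'', ''r'', ''dom'', ''out''}" and ?o = "s ''ord''"
  \<comment> \<open>After \<open>k\<close> rounds the indices from \<open>N - k\<close> on are
    decided. \<open>dom\<close> records which rows the kept columns dominate, which is all that
    later decisions need to know about \<open>K\<close>.\<close>
  let ?G = "\<lambda>m K s'. greedy_choice E ?o m N K \<and> s' ''out'' 0 = card K \<and>
    (\<forall>r<N. s' ''dom'' r = (if \<exists>i \<in> K. E (?o i) r then 1 else 0))"
  let ?I = "\<lambda>k t' s'. t' \<le> t + (150 * N + 100) * k + 3 \<and> agree ?X s s' \<and> (\<exists>K. ?G (N - k) K s')"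
  have ord: "?o i < N" if "i < N" for i
    using st that unfolding search_state_def mcs_order_def by auto
  have mark: "s ''mark'' r \<le> N" if "r < N" for r
    using st that unfolding search_state_def by fastforce
  show ?thesis
    unfolding choose_columns_def
  proof (rule wp_For[where N = N and I = ?I])
    have "?G N {} s" using s unfolding greedy_choice_def by simp
    then have "\<exists>K. ?G N K s" by blast
    then show "?I 0 (t + 3) (s(''k'' := (s ''k'')(0 := 0)))" by simp
  next
    fix k t' s'
    assume k: "k < N" "s' ''k'' 0 = k" "s' ''n'' 0 = N" and I: "?I k t' s'"
    then obtain K where ag: "agree ?X s s'" and K: "?G (N - k) K s'" by blast
    define m where "m = N - Suc k"
    have m: "m < N" "N - k = Suc m" "N - 1 - k = m" using k(1) unfolding m_def by auto
    let ?P = "\<exists>r. E (?o m) r \<and> r \<notin> marked E ?o m \<and> (\<forall>i \<in> K. \<not> E (?o i) r)"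
    let ?K = "if ?P then insert m K else K"
    have K': "greedy_choice E ?o m N ?K"
      using K m by (intro greedy_choice_Suc) auto
    have Km: "K \<subseteq> {Suc m..<N}" using K m unfolding greedy_choice_def by auto
    then have finK: "finite K" and mK: "m \<notin> K" using finite_subset by auto
    have cardK: "card K < N"
    proof -
      have "card K \<le> card {Suc m..<N}" using Km by (intro card_mono) auto
      then show ?thesis using m by simp
    qed
    have oW: "?o m < W" using ord[OF m(1)] W_bounds by blast
    have eq: "s' ''ord'' = ?o" "s' ''mark'' = s ''mark''" using ag by (auto simp: agree_def)
    let ?Q = "\<lambda>t s. s ''k'' 0 = k \<and> s ''n'' 0 = N \<and> ?I (Suc k) (t + 6) (s(''k'' := (s ''k'')(0 := Suc k)))"
    let ?upd = "Seq (Assign ''out'' (Const 0) (Plus (Var ''out'') (Const 1))) dominate_column"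
    let ?e = "Cell ''ord'' (Minus (Minus (Var ''n'') (Const 1)) (Var ''k''))"
    let ?s = "s'(''c'' := (s' ''c'')(0 := ?o m), ''b'' := (s' ''b'')(0 := 0))"
    \<comment> \<open>The 19 steps are 6 for the loop test, 10 for fetching the column and 3 for
      resetting \<open>b\<close>.\<close>
    have "wp W test_column (wp W (If (Var ''b'') ?upd Skip) ?Q) (t' + 19) ?s"
    proof (rule wp_test_column[where k = k])
      show "?s ''dom'' r \<le> 1" if "r < N" for r using K that by simp
      fix t1 s1
      assume t1: "t1 \<le> t' + 19 + 80 * N + 10" and a1: "agree {''r'', ''b''} ?s s1"
        and b: "s1 ''b'' 0 < W" "s1 ''b'' 0 \<noteq> 0 \<longleftrightarrow> (\<exists>r<N. ?s ''mark'' r = N - k \<and> ?s ''dom'' r = 0)"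
      have bP: "s1 ''b'' 0 \<noteq> 0 \<longleftrightarrow> ?P"
      proof -
        have "s1 ''b'' 0 \<noteq> 0 \<longleftrightarrow> (\<exists>r<N. s ''mark'' r = Suc m \<and> s' ''dom'' r = 0)"
          using b(2) eq m by simp
        also have "\<dots> \<longleftrightarrow> (\<exists>r<N. E (?o m) r \<and> r \<notin> marked E ?o m \<and> (\<forall>i \<in> K. \<not> E (?o i) r))"
        proof -
          have "s ''mark'' r = Suc m \<and> s' ''dom'' r = 0 \<longleftrightarrow>
              E (?o m) r \<and> r \<notin> marked E ?o m \<and> (\<forall>i \<in> K. \<not> E (?o i) r)" if "r < N" for r
            using search_state_first[OF st that m(1)] K that by auto
          then show ?thesis by blast
        qed
        also have "\<dots> \<longleftrightarrow> ?P" using sym bounded by blast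
        finally show ?thesis .
      qed
      have eq1: "s1 ''out'' 0 = card K" "s1 ''k'' 0 = k" "s1 ''n'' 0 = N" "s1 ''c'' 0 = ?o m"
        "s1 ''dom'' = s' ''dom''"
        using a1 K k by (auto simp: agree_def)
      have ag1: "agree ?X s s1" using ag a1 unfolding agree_def by auto
      show "wp W (If (Var ''b'') ?upd Skip) ?Q t1 s1"
      proof (rule wp_If)
        show "fits W (Var ''b'') s1" using b(1) W_bounds by simp
      next
        assume "val (Var ''b'') s1 \<noteq> 0"
        then have P: ?P using bP by simp
        let ?s1 = "s1(''out'' := (s1 ''out'')(0 := card K + 1))"
        have "wp W dominate_column ?Q (t1 + 9) ?s1"
        proof (rule wp_dominate_column[where c = "?o m"])
          show "adjacency N E ?s1" using s(1) ag1 by (auto simp: adjacency_def agree_def)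
          show "?s1 ''c'' 0 = ?o m" "?o m < N" using eq1 ord m by auto
          fix t2 s2
          assume t2: "t2 \<le> t1 + 9 + 60 * N + 10" and a2: "agree {''r'', ''dom''} ?s1 s2"
            and d2: "\<And>r. r < N \<Longrightarrow> s2 ''dom'' r = (if E (?o m) r then 1 else ?s1 ''dom'' r)"
          have eq2: "s2 ''out'' 0 = card K + 1" "s2 ''k'' 0 = k" "s2 ''n'' 0 = N"
            using a2 eq1 by (auto simp: agree_def)
          have "agree ?X s s2" using ag1 a2 unfolding agree_def by auto
          moreover have "?G m (insert m K) s2"
            using K' P eq2 d2 eq1 K finK mK by auto
          then have "\<exists>K. ?G m K s2" by blast
          moreover have "t2 + 6 \<le> t + (150 * N + 100) * Suc k + 3"
            using conjunct1[OF I] t1 t2 by simp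
          ultimately show "?Q t2 s2" using eq2 unfolding m_def by simp
        qed
        moreover have "t1 + (1 + cost (Var ''b'')) +
            (1 + cost (Const 0) + cost (Plus (Var ''out'') (Const 1))) = t1 + 9" by simp
        moreover have "s1(''out'' := (s1 ''out'')(val (Const 0) s1 := val (Plus (Var ''out'') (Const 1)) s1)) = ?s1"
          using eq1 by simp
        ultimately have "wp W dominate_column ?Q (t1 + (1 + cost (Var ''b'')) +
            (1 + cost (Const 0) + cost (Plus (Var ''out'') (Const 1))))
            (s1(''out'' := (s1 ''out'')(val (Const 0) s1 := val (Plus (Var ''out'') (Const 1)) s1)))"
          by (simp only:)
        then show "wp W ?upd ?Q (t1 + (1 + cost (Var ''b''))) s1"
          by (intro wp_Seq wp_Assign) (use W_bounds eq1 cardK in auto)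
      next
        assume "val (Var ''b'') s1 = 0"
        then have "\<not> ?P" using bP by simp
        then have "?K = K" by (rule if_not_P)
        then have "greedy_choice E ?o m N K" using K' by (simp only:)
        then have "?G m K s1" using eq1 K by auto
        then have "\<exists>K. ?G m K s1" by blast
        moreover have "t1 + 10 \<le> t + (150 * N + 100) * Suc k + 3"
          using conjunct1[OF I] t1 by simp
        ultimately show "wp W Skip ?Q (t1 + (1 + cost (Var ''b''))) s1"
          using ag1 eq1 unfolding m_def by (intro wp_Skip) simp
      qed
    qed (use k eq mark in auto)
    moreover have "t' + 6 + (1 + cost (Const 0) + cost ?e) + (1 + cost (Const 0) + cost (Const 0)) = t' + 19"
      by simp
    moreover have "s'(''c'' := (s' ''c'')(val (Const 0) s' := val ?e s'),
        ''b'' := (s' ''b'')(0 := 0)) = ?s"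
      using k eq m by simp
    moreover have "s'(''c'' := a, ''b'' := ((s'(''c'' := a)) ''b'')
        (val (Const 0) (s'(''c'' := a)) := val (Const 0) (s'(''c'' := a)))) =
        s'(''c'' := a, ''b'' := (s' ''b'')(0 := 0))" for a by simp
    ultimately have "wp W test_column (wp W (If (Var ''b'') ?upd Skip) ?Q)
        (t' + 6 + (1 + cost (Const 0) + cost ?e) + (1 + cost (Const 0) + cost (Const 0)))
        (s'(''c'' := (s' ''c'')(val (Const 0) s' := val ?e s'),
          ''b'' := ((s'(''c'' := (s' ''c'')(val (Const 0) s' := val ?e s'))) ''b'')
            (val (Const 0) (s'(''c'' := (s' ''c'')(val (Const 0) s' := val ?e s'))) :=
              val (Const 0) (s'(''c'' := (s' ''c'')(val (Const 0) s' := val ?e s'))))))"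
      by (simp only:)
    then show "wp W (Seq (Assign ''c'' (Const 0) (Cell ''ord'' (Minus (Minus (Var ''n'') (Const 1)) (Var ''k''))))
       (Seq (Assign ''b'' (Const 0) (Const 0)) (Seq test_column (If (Var ''b'') ?upd Skip)))) ?Q (t' + 6) s'"
      using W_bounds k eq m oW by (intro wp_Seq wp_Assign) auto
  next
    fix t' s' assume I: "?I N t' s'"
    then obtain K where K: "?G 0 K s'" by auto
    have "(150 * N + 100) * N + 9 \<le> 300 * (N + 1) * (N + 1)" by (simp add: algebra_simps)
    then have "t' + 6 \<le> t + 300 * (N + 1) * (N + 1)" using conjunct1[OF I] by linarith
    then show "Q (t' + 6) s'" using I K by (intro Q[of _ _ K]) blast+
  qed (use W_bounds s in \<open>auto simp: adjacency_def\<close>)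
qed

text \<open>Each pass contributes 300, and the remaining 100 absorbs the final linear loop. The
  search order exhausts all vertices, so rows with mark 0 are the isolated ones.\<close>

lemma wp_program:
  assumes s: "adjacency N E s" and zero: "\<And>x i. x \<noteq> ''n'' \<Longrightarrow> x \<noteq> ''adj'' \<Longrightarrow> s x i = 0"
  shows "wp W (Seq search (Seq choose_columns add_isolated)) (\<lambda>t' s'. t' \<le> t + 700 * (N + 1) * (N + 1) \<and>
    (\<exists>c K. mcs_order {..<N} E N c \<and> greedy_choice E c 0 N K \<and>
      s' ''out'' 0 = card K + card {r \<in> {..<N}. \<forall>v. \<not> E v r})) t s"
    (is "wp W _ ?Q t s")
proof (intro wp_Seq wp_search)
  fix t1 s1
  assume t1: "t1 \<le> t + 300 * (N + 1) * (N + 1)"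
    and a1: "agree {''k'', ''b'', ''j'', ''c'', ''used'', ''ord'', ''r'', ''cnt'', ''mark''} s s1"
    and st: "search_state N (s1 ''ord'') (s1 ''used'') (s1 ''mark'') (s1 ''cnt'')"
  have mcs: "mcs_order {..<N} E N (s1 ''ord'')" using st unfolding search_state_def by blast
  have surj: "s1 ''ord'' ` {..<N} = {..<N}"
    using mcs unfolding mcs_order_def by (intro card_subset_eq) (auto simp: card_image)
  show "wp W choose_columns (wp W add_isolated ?Q) t1 s1"
  proof (rule wp_choose_columns)
    show "adjacency N E s1" using s a1 by (auto simp: agree_def adjacency_def)
    show "s1 ''out'' 0 = 0" "s1 ''dom'' r = 0" for r using zero a1 by (auto simp: agree_def)
    fix t2 s2 K
    assume t2: "t2 \<le> t1 + 300 * (N + 1) * (N + 1)"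
      and a2: "agree {''k'', ''c'', ''b'', ''r'', ''dom'', ''out''} s1 s2"
      and K: "greedy_choice E (s1 ''ord'') 0 N K" "s2 ''out'' 0 = card K"
    have eq: "s2 ''mark'' = s1 ''mark''" "s2 ''n'' 0 = N"
      using a1 a2 s by (auto simp: agree_def adjacency_def)
    show "wp W add_isolated ?Q t2 s2"
    proof (rule wp_add_isolated)
      have "K \<subseteq> {0..<N}" using K(1) unfolding greedy_choice_def by blast
      then have "card K \<le> card {0..<N}" by (intro card_mono) auto
      then show "s2 ''out'' 0 \<le> N" using K(2) by simp
      show "s2 ''mark'' r \<le> N" if "r < N" for r
        using st that eq unfolding search_state_def by fastforce
      fix t3 and s3 :: state
      assume t3: "t3 \<le> t2 + 40 * N + 10"
        and out: "s3 ''out'' 0 = s2 ''out'' 0 + card {r. r < N \<and> s2 ''mark'' r = 0}"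
      have "s1 ''mark'' r = 0 \<longleftrightarrow> (\<forall>v. \<not> E v r)" if "r < N" for r
      proof -
        have "r \<in> marked E (s1 ''ord'') N \<longleftrightarrow> (\<exists>v \<in> s1 ''ord'' ` {..<N}. E v r)"
          unfolding marked_def by auto
        also have "\<dots> \<longleftrightarrow> (\<exists>v. E v r)" unfolding surj using bounded by auto
        finally show ?thesis using search_state_marked[OF st that] by simp
      qed
      then have "{r. r < N \<and> s2 ''mark'' r = 0} = {r \<in> {..<N}. \<forall>v. \<not> E v r}" using eq by auto
      moreover have "t3 \<le> t + 700 * (N + 1) * (N + 1)"
        using t1 t2 t3 by (simp add: algebra_simps)
      ultimately show "?Q t3 s3" using mcs K out by auto
    qed (use eq in auto)
  qed (use st in auto)
qed (use s zero in auto)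

end
end

section \<open>From the program to the time bounds\<close>

lemma adjacency_graph_input:
  assumes "card (verts G) = n"
  shows "adjacency n (\<lambda>u v. u \<rightarrow>\<^bsub>G\<^esub> v) (graph_input G)"
  using assms index_less by (auto simp: adjacency_def graph_input_def Let_def)

text \<open>One program serves all three problems, since \<open>f\<close> enters only through its
  value in terms of \<open>K\<close> and the isolated vertices.\<close>

lemma chordal_bipartite_solvable:
  assumes P: "\<And>G. P G \<Longrightarrow> chordal_bipartite G"
    and f: "\<And>G n c K. \<lbrakk>P G; mcs_order (verts G) (\<lambda>u v. u \<rightarrow>\<^bsub>G\<^esub> v) n c; c ` {..<n} = verts G;
      greedy_choice (\<lambda>u v. u \<rightarrow>\<^bsub>G\<^esub> v) c 0 n K\<rbrakk> \<Longrightarrow>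
      f G = card K + card {v \<in> verts G. neighbors G v = {}}"
  shows "solvable_in_time P f (\<lambda>n. real n ^ 2)"
proof -
  let ?p = "Seq search (Seq choose_columns add_isolated)"
  let ?T = "\<lambda>n::nat. 700 * (n + 1) * (n + 1)"
  have bound: "(\<lambda>n. real (?T n)) \<in> O(\<lambda>n. real n ^ 2)"
  \<comment> \<open>The constant is 700 times 4, from \<open>n + 1 \<le> 2 * n\<close> for positive
    \<open>n\<close>.\<close>
  proof (rule bigoI[where c = 2800])
    show "\<forall>\<^sub>F n in sequentially. norm (real (?T n)) \<le> 2800 * norm (real n ^ 2)"
      using eventually_ge_at_top[of 1]
    proof eventually_elim
      case (elim n)
      then have "(n + 1) * (n + 1) \<le> (2 * n) * (2 * n)" by (intro mult_le_mono) auto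
      then have "?T n \<le> 2800 * (n * n)" by linarith
      then have "real (?T n) \<le> real (2800 * (n * n))" by (rule of_nat_mono)
      then show ?case by (simp add: power2_eq_square)
    qed
  qed
  have run: "\<exists>t s. exec ((n + 2) ^ 3) ?p (graph_input G) t s \<and> t \<le> ?T n \<and> s ''out'' 0 = f G"
    if G: "P G" "verts G = {..<n}" for n G
  proof -
    let ?E = "\<lambda>u v. u \<rightarrow>\<^bsub>G\<^esub> v"
    obtain side where "bipartite_no_long_hole (verts G) ?E side"
      using chordal_bipartite_no_long_hole[OF P[OF G(1)]] by blast
    then interpret bipartite_no_long_hole "verts G" ?E side .
    \<comment> \<open>The exponent 2 fails at \<open>n = 0\<close>, where both sides would be
      4.\<close>
    have W: "n * n + 2 * n + 4 < (n + 2) ^ 3"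
      by (simp add: power3_eq_cube algebra_simps)
    have "wp ((n + 2) ^ 3) ?p (\<lambda>t s. t \<le> 0 + 700 * (n + 1) * (n + 1) \<and>
      (\<exists>c K. mcs_order {..<n} ?E n c \<and> greedy_choice ?E c 0 n K \<and>
        s ''out'' 0 = card K + card {r \<in> {..<n}. \<forall>v. \<not> ?E v r})) 0 (graph_input G)"
    proof (rule wp_program[OF W])
      show "?E v u" if "?E u v" for u v using sym[OF that] .
      show "u < n" if "?E u v" for u v using adj_in_V[OF that] G(2) by simp
      show "adjacency n ?E (graph_input G)" using G(2) by (intro adjacency_graph_input) simp
      show "graph_input G x i = 0" if "x \<noteq> ''n''" "x \<noteq> ''adj''" for x i
        using that by (simp add: graph_input_def Let_def)
    qed
    then obtain t s c K where ex: "exec ((n + 2) ^ 3) ?p (graph_input G) t s" "t \<le> ?T n"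
      and mcs: "mcs_order (verts G) ?E n c" and K: "greedy_choice ?E c 0 n K"
      and out: "s ''out'' 0 = card K + card {r \<in> verts G. \<forall>v. \<not> ?E v r}"
      unfolding wp_def G(2) by auto
    have "c ` {..<n} = verts G" using mcs_order_surj[of "verts G" ?E c] mcs G(2) by simp
    moreover have "(\<forall>v. \<not> ?E v r) \<longleftrightarrow> neighbors G r = {}" for r
      using sym adj_in_V unfolding neighbors_def by blast
    ultimately have "s ''out'' 0 = f G" using f[OF G(1) mcs _ K] out by simp
    then show ?thesis using ex by blast
  qed
  show ?thesis
    unfolding solvable_in_time_def
  proof (rule exI[of _ ?p], rule exI[of _ 3], rule exI[of _ ?T], intro conjI allI impI)
    show "(\<lambda>n. real (?T n)) \<in> O(\<lambda>n. real n ^ 2)" by (fact bound)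
    show "\<exists>t s. exec ((n + 2) ^ 3) ?p (graph_input G) t s \<and> t \<le> ?T n \<and> s ''out'' 0 = f G"
      if "P G \<and> verts G = {..<n}" for n G
      using that by (intro run) blast+
  qed
qed

theorem theorem3:
  shows "(\<forall>G :: ('a, 'b) pre_digraph. chordal_bipartite G \<longrightarrow> cd_perfect G)
    \<and> (\<forall>G :: ('a, 'b) pre_digraph. chordal_bipartite G \<and> no_isolated G \<longrightarrow>
          total_domination_number G = cd_chromatic_number G
        \<and> cd_chromatic_number G = separated_cluster_number G
        \<and> (\<forall>k. ((\<exists>S. total_dominating_set G S \<and> card S \<le> k) \<longleftrightarrow>
                 (\<exists>f. cd_coloring G f \<and> card (f ` verts G) \<le> k))
             \<and> ((\<exists>f. cd_coloring G f \<and> card (f ` verts G) \<le> k) \<longleftrightarrow>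
                 \<not> (\<exists>S. separated_cluster G S \<and> card S \<ge> k + 1))))
    \<and> solvable_in_time (\<lambda>G. chordal_bipartite G \<and> no_isolated G)
        total_domination_number (\<lambda>n. real n ^ 2)
    \<and> solvable_in_time chordal_bipartite cd_chromatic_number (\<lambda>n. real n ^ 2)
    \<and> solvable_in_time chordal_bipartite separated_cluster_number (\<lambda>n. real n ^ 2)"
proof (intro conjI allI impI)
  fix G :: "('a, 'b) pre_digraph"
  show "cd_perfect G" if "chordal_bipartite G"
    using that by (rule chordal_bipartite_cd_perfect)
next
  fix G :: "('a, 'b) pre_digraph" and k
  assume "chordal_bipartite G \<and> no_isolated G"
  then have G: "chordal_bipartite G" "no_isolated G" by auto
  note d = chordal_bipartite_duality[OF G]
  show "total_domination_number G = cd_chromatic_number G" by (fact d(1))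
  show "cd_chromatic_number G = separated_cluster_number G" by (fact d(2))
  show "(\<exists>S. total_dominating_set G S \<and> card S \<le> k) \<longleftrightarrow>
      (\<exists>f. cd_coloring G f \<and> card (f ` verts G) \<le> k)" by (fact d(3))
  show "(\<exists>f. cd_coloring G f \<and> card (f ` verts G) \<le> k) \<longleftrightarrow>
      \<not> (\<exists>S. separated_cluster G S \<and> card S \<ge> k + 1)" by (fact d(4))
next
  show "solvable_in_time (\<lambda>G. chordal_bipartite G \<and> no_isolated G)
      total_domination_number (\<lambda>n. real n ^ 2)"
    by (rule chordal_bipartite_solvable)
      (erule conjunct1, rule chordal_bipartite_numbers(3)[OF _ _ _ _ refl], erule conjunct1,
        assumption+, erule conjunct2)
  show "solvable_in_time chordal_bipartite cd_chromatic_number (\<lambda>n. real n ^ 2)"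
    by (rule chordal_bipartite_solvable)
      (assumption | rule chordal_bipartite_numbers(2)[OF _ _ _ _ refl])+
  show "solvable_in_time chordal_bipartite separated_cluster_number (\<lambda>n. real n ^ 2)"
    by (rule chordal_bipartite_solvable)
      (assumption | rule chordal_bipartite_numbers(1)[OF _ _ _ _ refl])+
qed

end
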